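(* Let $\mathcal{B}$ be a dense $*$-subalgebra of a C$^*$-algebra $\mathcal{A}$, and suppose that $\mathcal{B}$ is closed under the C$^\infty$-functional calculus of $\mathcal{A}$. Then the only C$^*$-norm which may possibly be defined on $\mathcal{B}$ is the restriction of $\|\cdot\|_{\mathcal{A}}$ to $\mathcal{B}$.
   Context: $\|\cdot\|_{\mathcal{A}}$ is the C$^*$-norm of $\mathcal{A}$. A C$^*$-norm on a $*$-algebra $\mathcal{B}$ (not assumed complete) is a vector space norm $p$ with $p(ab)\leqslant p(a)p(b)$, $p(b^* )=p(b)$ and $p(b^*b)=p(b)^2$ for all $a,b\in\mathcal{B}$. Notation $\dot{\mathcal{A}},\dot{\mathcal{B}}$: for an algebra $\mathcal{A}$ and a subalgebra $\mathcal{B}$, if $\mathcal{A}$ is non-unital then $\dot{\mathcal{A}}:=\tilde{\mathcal{A}}$ and $\dot{\mathcal{B}}:=\tilde{\mathcal{B}}$ (unitizations, $\tilde{\mathcal{B}}\subseteq\tilde{\mathcal{A}}$); if $\mathcal{A}$ and $\mathcal{B}$ are both unital with the same unit, then $\dot{\mathcal{A}}:=\mathcal{A}$, $\dot{\mathcal{B}}:=\mathcal{B}$; if $\mathcal{A}$ is unital but $1_{\mathcal{A}}\notin\mathcal{B}$, then $\dot{\mathcal{A}}:=\mathcal{A}$ and $\dot{\mathcal{B}}$ is the subalgebra of $\mathcal{A}$ generated by $\mathcal{B}$ and $1_{\mathcal{A}}$. A $*$-subalgebra $\mathcal{B}$ of a C$^*$-algebra $\mathcal{A}$ is closed under the C$^\infty$-functional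 calculus of $\mathcal{A}$ if, for every self-adjoint $b\in\dot{\mathcal{B}}$ and every smooth function $f$ on an open neighborhood $U\subseteq\mathbb{R}$ of the spectrum $\sigma_{\dot{\mathcal{A}}}(b)$, one has $f(b)\in\dot{\mathcal{B}}$, where $f(b)$ is computed by the continuous functional calculus of $\dot{\mathcal{A}}$. *)

theory Defs
  imports "HOL-Analysis.Analysis"
begin

text \<open>Complex *-algebras, not necessarily unital (\<^class>\<open>ring\<close> has no multiplicative unit).\<close>

class complex_star_algebra = ring +
  fixes scaleC :: "complex \<Rightarrow> 'a \<Rightarrow> 'a"  (infixr "*\<^sub>C" 75)
    and star :: "'a \<Rightarrow> 'a"
  assumes scaleC_add_right: "c *\<^sub>C (x + y) = c *\<^sub>C x + c *\<^sub>C y"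
    and scaleC_add_left: "(c + d) *\<^sub>C x = c *\<^sub>C x + d *\<^sub>C x"
    and scaleC_scaleC: "c *\<^sub>C d *\<^sub>C x = (c * d) *\<^sub>C x"
    and scaleC_one: "1 *\<^sub>C x = x"
    and mult_scaleC_left: "(c *\<^sub>C x) * y = c *\<^sub>C (x * y)"
    and mult_scaleC_right: "x * (c *\<^sub>C y) = c *\<^sub>C (x * y)"
    and star_add: "star (x + y) = star x + star y"
    and star_scaleC: "star (c *\<^sub>C x) = cnj c *\<^sub>C star x"
    and star_mult: "star (x * y) = star y * star x"
    and star_star: "star (star x) = x"

class cstar_algebra = complex_star_algebra + real_normed_algebra + banach +
  assumes scaleR_scaleC: "r *\<^sub>R x = complex_of_real r *\<^sub>C x"
    and norm_scaleC: "norm (c *\<^sub>C x) = cmod c * norm x"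
    and cstar_identity: "norm (star x * x) = (norm x)\<^sup>2"

definition is_unity :: "'a::complex_star_algebra \<Rightarrow> bool"
  where "is_unity e \<longleftrightarrow> (\<forall>x. e * x = x \<and> x * e = x)"

definition unital :: "'a::complex_star_algebra itself \<Rightarrow> bool"
  where "unital _ \<longleftrightarrow> (\<exists>e::'a. is_unity e)"

text \<open>The unit of a unital algebra; unspecified (and not used) when there is none.\<close>

definition unity :: "'a::complex_star_algebra"
  where "unity = (THE e. is_unity e)"

definition complex_subalgebra :: "'a::complex_star_algebra set \<Rightarrow> bool"
  where "complex_subalgebra B \<longleftrightarrow> 0 \<in> B \<and> (\<forall>x\<in>B. \<forall>y\<in>B. x + y \<in> B) \<and>
    (\<forall>c. \<forall>x\<in>B. c *\<^sub>C x \<in> B) \<and> (\<forall>x\<in>B. \<forall>y\<in>B. x * y \<in> B)"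

definition star_subalgebra :: "'a::complex_star_algebra set \<Rightarrow> bool"
  where "star_subalgebra B \<longleftrightarrow> complex_subalgebra B \<and> (\<forall>x\<in>B. star x \<in> B)"

definition generated_subalgebra :: "'a::complex_star_algebra set \<Rightarrow> 'a set"
  where "generated_subalgebra S = \<Inter>{C. complex_subalgebra C \<and> S \<subseteq> C}"

text \<open>The unitization, as a *-algebra: \<open>Unitization a c\<close> stands for \<open>a + c1\<close>.\<close>

datatype 'a unitization = Unitization (alg_part: 'a) (scalar_part: complex)

instantiation unitization :: (complex_star_algebra) complex_star_algebra
begin

definition "0 = Unitization 0 0"
definition "x + y = Unitization (alg_part x + alg_part y) (scalar_part x + scalar_part y)"
definition "- x = Unitization (- alg_part x) (- scalar_part x)"
definition "x - y = Unitization (alg_part x - alg_part y) (scalar_part x - scalar_part y)"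
definition "x * y = Unitization
  (alg_part x * alg_part y + scalar_part y *\<^sub>C alg_part x + scalar_part x *\<^sub>C alg_part y)
  (scalar_part x * scalar_part y)"
definition "c *\<^sub>C x = Unitization (c *\<^sub>C alg_part x) (c * scalar_part x)"
definition "star x = Unitization (star (alg_part x)) (cnj (scalar_part x))"

instance
  by standard
    (simp_all add: zero_unitization_def plus_unitization_def uminus_unitization_def
      minus_unitization_def times_unitization_def scaleC_unitization_def star_unitization_def
      unitization.expand scaleC_add_right scaleC_add_left scaleC_scaleC scaleC_one
      mult_scaleC_left mult_scaleC_right star_add star_scaleC star_mult star_star
      algebra_simps)

end

definition unitization_of :: "'a::complex_star_algebra set \<Rightarrow> 'a unitization set"
  where "unitization_of B = {Unitization b c | b c. b \<in> B}"

definition spectrum :: "'a::complex_star_algebra \<Rightarrow> complex set"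
  where "spectrum b =
    {z. \<not> (\<exists>c. c * (z *\<^sub>C unity - b) = unity \<and> (z *\<^sub>C unity - b) * c = unity)}"

text \<open>
  \<open>cfc_hom b \<Phi>\<close>: \<open>\<Phi>\<close> is a unital *-homomorphism from the continuous functions on the spectrum
  of \<open>b\<close> to the (unital) ambient algebra with \<open>\<Phi>(id) = b\<close>. Elements of \<open>C(\<sigma>(b))\<close> are
  represented by total functions continuous on the spectrum; the first clause says that
  \<open>\<Phi>\<close> depends only on their restrictions to it. For self-adjoint \<open>b\<close> in a unital C*-algebra
  there is exactly one such homomorphism on \<open>C(\<sigma>(b))\<close>; it is automatically isometric.
\<close>

definition cfc_hom :: "'a::complex_star_algebra \<Rightarrow> ((complex \<Rightarrow> complex) \<Rightarrow> 'a) \<Rightarrow> bool"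
  where "cfc_hom b \<Phi> \<longleftrightarrow>
    (\<forall>f g. continuous_on (spectrum b) f \<longrightarrow> continuous_on (spectrum b) g \<longrightarrow>
       ((\<forall>z\<in>spectrum b. f z = g z) \<longrightarrow> \<Phi> f = \<Phi> g) \<and>
       \<Phi> (\<lambda>z. f z + g z) = \<Phi> f + \<Phi> g \<and>
       \<Phi> (\<lambda>z. f z * g z) = \<Phi> f * \<Phi> g) \<and>
    (\<forall>f. continuous_on (spectrum b) f \<longrightarrow>
       (\<forall>c. \<Phi> (\<lambda>z. c * f z) = c *\<^sub>C \<Phi> f) \<and>
       \<Phi> (\<lambda>z. cnj (f z)) = star (\<Phi> f)) \<and>
    \<Phi> (\<lambda>z. 1) = unity \<and>
    \<Phi> (\<lambda>z. z) = b"

definition cfc :: "(complex \<Rightarrow> complex) \<Rightarrow> 'a::complex_star_algebra \<Rightarrow> 'a"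
  where "cfc f b = (THE y. \<exists>\<Phi>. cfc_hom b \<Phi> \<and> \<Phi> f = y)"

text \<open>Smoothness on an open set \<open>U\<close>; \<open>D n\<close> is the \<open>n\<close>-th derivative of \<open>f\<close> on \<open>U\<close>.\<close>

definition smooth_on_open :: "real set \<Rightarrow> (real \<Rightarrow> complex) \<Rightarrow> bool"
  where "smooth_on_open U f \<longleftrightarrow> (\<exists>D :: nat \<Rightarrow> real \<Rightarrow> complex.
    (\<forall>x\<in>U. D 0 x = f x) \<and>
    (\<forall>n. \<forall>x\<in>U. (D n has_vector_derivative D (Suc n) x) (at x)))"

text \<open>
  The closure condition for a subset \<open>D\<close> of a unital algebra. The spectrum is that of the
  ambient algebra; it is real for self-adjoint elements of a C*-algebra, so a function \<open>f\<close> of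
  a real variable is viewed as the function \<open>\<lambda>z. f (Re z)\<close> on it.
\<close>

definition smooth_cfc_closed_unital :: "'a::complex_star_algebra set \<Rightarrow> bool"
  where "smooth_cfc_closed_unital D \<longleftrightarrow>
    (\<forall>b\<in>D. star b = b \<longrightarrow>
      (\<forall>U f. open U \<longrightarrow> spectrum b \<subseteq> complex_of_real ` U \<longrightarrow> smooth_on_open U f \<longrightarrow>
        cfc (\<lambda>z. f (Re z)) b \<in> D))"

text \<open>
  The three cases below pass from \<open>B\<close> and the ambient algebra to \<open>B\<close> and the ambient algebra
  with unit adjoined, the latter being a different type only in the last case.
\<close>

definition smooth_cfc_closed :: "'a::cstar_algebra set \<Rightarrow> bool"
  where "smooth_cfc_closed B \<longleftrightarrow>
    (if unital TYPE('a) then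
       (if unity \<in> B then smooth_cfc_closed_unital B
        else smooth_cfc_closed_unital (generated_subalgebra (insert unity B)))
     else smooth_cfc_closed_unital (unitization_of B))"

definition cstar_norm_on :: "'a::complex_star_algebra set \<Rightarrow> ('a \<Rightarrow> real) \<Rightarrow> bool"
  where "cstar_norm_on B p \<longleftrightarrow>
    (\<forall>a\<in>B. 0 \<le> p a \<and> (p a = 0 \<longleftrightarrow> a = 0)) \<and>
    (\<forall>a\<in>B. \<forall>b\<in>B. p (a + b) \<le> p a + p b) \<and>
    (\<forall>c. \<forall>a\<in>B. p (c *\<^sub>C a) = cmod c * p a) \<and>
    (\<forall>a\<in>B. \<forall>b\<in>B. p (a * b) \<le> p a * p b) \<and>
    (\<forall>a\<in>B. p (star a) = p a) \<and>
    (\<forall>a\<in>B. p (star a * a) = (p a)\<^sup>2)"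

lemma norm_star: "norm (star x) = norm (x::'a::cstar_algebra)"
proof -
  have le: "norm y \<le> norm (star y)" for y :: 'a
  proof (cases "norm y = 0")
    case False
    have "norm y * norm y \<le> norm (star y) * norm y"
      using norm_mult_ineq[of "star y" y] cstar_identity[of y] by (simp add: power2_eq_square)
    with False show ?thesis by simp
  qed simp
  show ?thesis using le[of x] le[of "star x"] by (simp add: star_star)
qed

lemma cstar_norm_on_norm: "cstar_norm_on B (norm :: 'a::cstar_algebra \<Rightarrow> real)"
  by (simp add: cstar_norm_on_def norm_triangle_ineq norm_scaleC norm_mult_ineq norm_star
      cstar_identity)

end

theory Submission
  imports Defs "HOL-Computational_Algebra.Fundamental_Theorem_Algebra"
begin

text \<open>
  Let \<open>p\<close> be a C*-norm on \<open>B\<close>. By the C*-identity it suffices to compare \<open>p b\<close> and \<open>\<parallel>b\<parallel>\<close> for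
  self-adjoint \<open>b\<close>, and no completion of \<open>B\<close> is needed for this.
  If \<open>\<parallel>b\<parallel> < 1\<close>, then \<open>c = \<surd>(1 - b\<^sup>2)\<close> is a smooth function of \<open>b\<close> and \<open>b \<plusminus> \<i>c\<close> are unitaries that
  multiply \<open>B\<close> into itself, hence isometrically for \<open>p\<close>; so \<open>p b \<le> 1\<close>.
  Conversely, suppose \<open>p b < r < \<parallel>b\<parallel>\<close>, and (replacing \<open>b\<close> by \<open>-b\<close>) that \<open>\<parallel>b\<parallel>\<close> lies in the spectrum. Let
  \<open>f \<ge> 0\<close> be smooth, zero on \<open>t \<le> r\<close> and positive on \<open>t > r\<close>. With \<open>f\<^sub>n t = f t / t\<^sup>n\<close> one
  has \<open>f(b) = b\<^sup>n f\<^sub>n(b)\<close>, so \<open>p (f(b)) \<le> (p b)\<^sup>n \<parallel>f\<^sub>n(b)\<parallel> \<le> (p b / r)\<^sup>n\<close>, which tends to \<open>0\<close>. Hence \<open>f(b) = 0\<close>,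
  although \<open>f\<close> does not vanish on the spectrum.
\<close>

section \<open>The unitization as a C*-algebra\<close>

interpretation scaleC: vector_space "scaleC :: complex \<Rightarrow> 'a::complex_star_algebra \<Rightarrow> 'a"
  by standard (simp_all add: scaleC_add_right scaleC_add_left scaleC_scaleC scaleC_one)

lemma star_zero [simp]: "star (0::'a::complex_star_algebra) = 0"
  using star_add[of "0::'a" 0] by simp

lemma star_minus: "star (- x) = - star (x::'a::complex_star_algebra)"
  using star_add[of x "- x"] by (simp add: eq_neg_iff_add_eq_0 add.commute)

lemma star_diff: "star (x - y) = star x - star (y::'a::complex_star_algebra)"
  using star_add[of x "- y"] by (simp add: star_minus)

lemma star_scaleR: "star (r *\<^sub>R x) = r *\<^sub>R star (x::'a::cstar_algebra)"
  by (simp add: scaleR_scaleC star_scaleC)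

lemma bounded_linear_star: "bounded_linear (star :: 'a::cstar_algebra \<Rightarrow> 'a)"
  by (rule bounded_linear_intro[where K = 1]) (simp_all add: star_add star_scaleR norm_star)

lemmas continuous_on_star [continuous_intros] =
  bounded_linear.continuous_on[OF bounded_linear_star]

lemmas tendsto_star [tendsto_intros] = bounded_linear.tendsto[OF bounded_linear_star]

lemma bounded_linear_scaleC: "bounded_linear (scaleC c :: 'a::cstar_algebra \<Rightarrow> 'a)"
  by (rule bounded_linear_intro[where K = "cmod c"])
    (simp_all add: scaleC_add_right scaleR_scaleC scaleC_scaleC mult.commute norm_scaleC)

lemma star_self_mult [simp]: "star (star x * x) = star x * (x::'a::complex_star_algebra)"
  by (simp add: star_mult star_star)

lemma is_unity_star:
  assumes "is_unity (e::'a::complex_star_algebra)"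
  shows "star e = e"
  using assms unfolding is_unity_def by (metis star_mult star_star)

lemma unity_eq: "is_unity (e::'a::complex_star_algebra) \<Longrightarrow> unity = e"
  unfolding unity_def by (rule the_equality) (auto simp: is_unity_def, metis)

lemma unital_iff: "unital TYPE('a::complex_star_algebra) \<longleftrightarrow> is_unity (unity::'a)"
  unfolding unital_def using unity_eq by metis

lemma unitization_sel [simp]:
  fixes u v :: "'a::complex_star_algebra unitization"
  shows "alg_part 0 = (0::'a)" "scalar_part (0::'a unitization) = 0"
    "alg_part (u + v) = alg_part u + alg_part v"
    "scalar_part (u + v) = scalar_part u + scalar_part v"
    "alg_part (u - v) = alg_part u - alg_part v"
    "scalar_part (u - v) = scalar_part u - scalar_part v"
    "alg_part (c *\<^sub>C u) = c *\<^sub>C alg_part u" "scalar_part (c *\<^sub>C u) = c * scalar_part u"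
    "alg_part (star u) = star (alg_part u)" "scalar_part (star u) = cnj (scalar_part u)"
    "alg_part (u * v) =
      alg_part u * alg_part v + scalar_part v *\<^sub>C alg_part u + scalar_part u *\<^sub>C alg_part v"
    "scalar_part (u * v) = scalar_part u * scalar_part v"
  by (simp_all add: zero_unitization_def plus_unitization_def minus_unitization_def
      scaleC_unitization_def star_unitization_def times_unitization_def)

section \<open>Left multiplication operators of the unitization\<close>

definition left_action :: "'a::cstar_algebra unitization \<Rightarrow> 'a \<Rightarrow> 'a"
  where "left_action u x = alg_part u * x + scalar_part u *\<^sub>C x"

lemma bounded_linear_left_action: "bounded_linear (left_action u)"
  unfolding left_action_def
  by (intro bounded_linear_add bounded_linear_scaleC bounded_linear_mult_right)

lemma left_action_plus: "left_action (u + v) = (\<lambda>x. left_action u x + left_action v x)"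
  by (auto simp: left_action_def algebra_simps scaleC_add_left)

lemma left_action_scaleC: "left_action (c *\<^sub>C u) = (\<lambda>x. c *\<^sub>C left_action u x)"
  by (auto simp: left_action_def scaleC_add_right scaleC_scaleC
      mult_scaleC_left)

lemma left_action_times: "left_action (u * v) = left_action u \<circ> left_action v"
  by (auto simp: left_action_def algebra_simps scaleC_add_right
      scaleC_scaleC mult_scaleC_left mult_scaleC_right)

text \<open>The product \<open>star x * y\<close> plays the part of an algebra-valued inner product,
  and \<open>star u\<close> acts as the adjoint of \<open>u\<close> for it. This replaces a Hilbert
  space in the norm estimates.\<close>

lemma left_action_adjoint: "star (left_action u x) * y = star x * left_action (star u) y"
  by (simp add: left_action_def algebra_simps star_add star_mult
      star_scaleC mult_scaleC_left mult_scaleC_right)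

lemma norm_left_action_le: "norm (left_action u x) \<le> onorm (left_action u) * norm x"
  by (rule onorm[OF bounded_linear_left_action])

lemma onorm_left_action_nonneg: "0 \<le> onorm (left_action u)"
  by (rule onorm_pos_le[OF bounded_linear_left_action])

lemma onorm_left_action_scaleC:
  "onorm (left_action (c *\<^sub>C u)) = cmod c * onorm (left_action u)"
proof -
  have "onorm (left_action (c *\<^sub>C u)) = onorm (\<lambda>x. cmod c *\<^sub>R left_action u x)"
    by (simp add: onorm_def left_action_scaleC norm_scaleC)
  then show ?thesis
    using onorm_scaleR[OF bounded_linear_left_action, of "cmod c" u] by simp
qed

text \<open>As for Hilbert space operators, expanding the square of \<parallel>u x\<parallel> gives
  \<parallel>u\<parallel>^2 \<le> \<parallel>\<open>star u * u\<close>\<parallel>. With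
  submultiplicativity this yields \<parallel>u\<parallel> \<le>
  \<parallel>\<open>star u\<close>\<parallel>, hence equality by symmetry, and then the reverse
  inequality.\<close>

lemma onorm_left_action_cstar: "onorm (left_action (star u * u)) = (onorm (left_action u))\<^sup>2"
proof -
  have le: "(onorm (left_action u))\<^sup>2 \<le> onorm (left_action (star u * u))" for u :: "'a unitization"
  proof -
    let ?m = "onorm (left_action (star u * u))"
    have "norm (left_action u x) \<le> sqrt ?m * norm x" for x
    proof -
      have "(norm (left_action u x))\<^sup>2 = norm (star x * left_action (star u * u) x)"
        by (simp add: cstar_identity[symmetric] left_action_adjoint left_action_times)
      also have "\<dots> \<le> norm x * (?m * norm x)"
        using norm_mult_ineq[of "star x" "left_action (star u * u) x"]
          mult_left_mono[OF norm_left_action_le[of "star u * u" x] norm_ge_zero[of x]]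
        by (simp add: norm_star)
      also have "\<dots> = (sqrt ?m * norm x)\<^sup>2"
        by (simp add: power_mult_distrib onorm_left_action_nonneg power2_eq_square)
      finally show ?thesis
        by (rule power2_le_imp_le) (simp add: onorm_left_action_nonneg)
    qed
    then have "onorm (left_action u) \<le> sqrt ?m"
      by (rule onorm_bound[rotated]) (simp add: onorm_left_action_nonneg)
    then have "(onorm (left_action u))\<^sup>2 \<le> (sqrt ?m)\<^sup>2"
      by (intro power_mono onorm_left_action_nonneg)
    then show ?thesis by (simp add: onorm_left_action_nonneg)
  qed
  have sub: "onorm (left_action (star u * u)) \<le> onorm (left_action (star u)) * onorm (left_action u)"
    for u :: "'a unitization"
    unfolding left_action_times
    by (rule onorm_compose) (rule bounded_linear_left_action)+
  have star_le: "onorm (left_action u) \<le> onorm (left_action (star u))" for u :: "'a unitization"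
  proof (cases "onorm (left_action u) = 0")
    case False
    then have "0 < onorm (left_action u)"
      using onorm_left_action_nonneg[of u] by simp
    moreover have "onorm (left_action u) * onorm (left_action u)
        \<le> onorm (left_action (star u)) * onorm (left_action u)"
      using le[of u] sub[of u] by (simp add: power2_eq_square)
    ultimately show ?thesis by simp
  qed (simp add: onorm_left_action_nonneg)
  have "onorm (left_action (star u)) = onorm (left_action u)"
    using star_le[of u] star_le[of "star u"] by (simp add: star_star)
  with le[of u] sub[of u] show ?thesis by (simp add: power2_eq_square)
qed

instantiation unitization :: (cstar_algebra) real_normed_algebra
begin

text \<open>
  The operator norm alone is definite only for a non-unital algebra; the maximum with the
  character \<open>scalar_part\<close> is a C*-norm in all cases.
\<close>

definition norm_unitization :: "'a unitization \<Rightarrow> real"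
  where "norm u = max (onorm (left_action u)) (cmod (scalar_part u))"

definition scaleR_unitization :: "real \<Rightarrow> 'a unitization \<Rightarrow> 'a unitization"
  where "scaleR_unitization r u = complex_of_real r *\<^sub>C u"

definition dist_unitization :: "'a unitization \<Rightarrow> 'a unitization \<Rightarrow> real"
  where "dist_unitization u v = norm (u - v)"

definition sgn_unitization :: "'a unitization \<Rightarrow> 'a unitization"
  where "sgn_unitization u = inverse (norm u) *\<^sub>R u"

definition uniformity_unitization :: "('a unitization \<times> 'a unitization) filter"
  where "uniformity_unitization = (INF e\<in>{0<..}. principal {(u::'a unitization, v). dist u v < e})"

definition open_unitization :: "'a unitization set \<Rightarrow> bool"
  where "open_unitization U \<longleftrightarrow> (\<forall>u\<in>U. eventually (\<lambda>(u', v). u' = u \<longrightarrow> v \<in> U) uniformity)"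

text \<open>Letting \<open>u\<close> act on the adjoint of its algebra part a recovers a
  \<open>star a\<close> up to the scalar term, whence the factor 2. With
  \<open>norm_unitization_le\<close> the norm becomes equivalent to the sum of the norms of the
  components; definiteness and completeness follow.\<close>

lemma norm_alg_part_le: "norm (alg_part u) \<le> 2 * norm (u::'a unitization)"
proof -
  let ?a = "alg_part u"
  have "norm ?a * norm ?a = norm (?a * star ?a)"
    using cstar_identity[of "star ?a"] by (simp add: star_star norm_star power2_eq_square)
  also have "?a * star ?a = left_action u (star ?a) - scalar_part u *\<^sub>C star ?a"
    by (simp add: left_action_def)
  also have "norm \<dots> \<le> onorm (left_action u) * norm ?a + cmod (scalar_part u) * norm ?a"
    using norm_triangle_ineq4[of "left_action u (star ?a)" "scalar_part u *\<^sub>C star ?a"]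
      norm_left_action_le[of u "star ?a"] by (simp add: norm_scaleC norm_star)
  also have "\<dots> \<le> 2 * norm u * norm ?a"
    by (simp add: norm_unitization_def mult_right_mono flip: distrib_right)
  finally show ?thesis
    by (cases "norm ?a = 0") (auto simp: norm_unitization_def le_max_iff_disj)
qed

lemma norm_scalar_part_le: "cmod (scalar_part u) \<le> norm (u::'a unitization)"
  by (simp add: norm_unitization_def)

lemma norm_unitization_le: "norm (u::'a unitization) \<le> norm (alg_part u) + cmod (scalar_part u)"
proof -
  have "onorm (left_action u) \<le> norm (alg_part u) + cmod (scalar_part u)"
  proof (rule onorm_bound)
    fix x
    show "norm (left_action u x) \<le> (norm (alg_part u) + cmod (scalar_part u)) * norm x"
      unfolding left_action_def distrib_right
      by (rule order_trans[OF norm_triangle_ineq])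
        (simp add: norm_scaleC norm_mult_ineq)
  qed simp
  then show ?thesis by (simp add: norm_unitization_def)
qed

instance
proof
  fix r s :: real and u v w :: "'a unitization" and U :: "'a unitization set"
  show "dist u v = norm (u - v)"
    by (rule dist_unitization_def)
  show "sgn u = inverse (norm u) *\<^sub>R u"
    by (rule sgn_unitization_def)
  show "(uniformity :: ('a unitization \<times> 'a unitization) filter) =
      (INF e\<in>{0<..}. principal {(u, v). dist u v < e})"
    by (rule uniformity_unitization_def)
  show "open U \<longleftrightarrow> (\<forall>u\<in>U. eventually (\<lambda>(u', v). u' = u \<longrightarrow> v \<in> U) uniformity)"
    by (rule open_unitization_def)
  show "r *\<^sub>R (u + v) = r *\<^sub>R u + r *\<^sub>R v" "(r + s) *\<^sub>R u = r *\<^sub>R u + s *\<^sub>R u"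
    "r *\<^sub>R s *\<^sub>R u = (r * s) *\<^sub>R u" "1 *\<^sub>R u = u"
    "r *\<^sub>R u * v = r *\<^sub>R (u * v)" "u * r *\<^sub>R v = r *\<^sub>R (u * v)"
    by (simp_all add: scaleR_unitization_def scaleC_add_right scaleC_add_left scaleC_scaleC
        scaleC_one mult_scaleC_left mult_scaleC_right)
  have norm_scaleC: "norm (d *\<^sub>C u) = cmod d * norm u" for d
    by (simp add: norm_unitization_def onorm_left_action_scaleC norm_mult
        max_mult_distrib_left)
  show "norm (r *\<^sub>R u) = \<bar>r\<bar> * norm u"
    by (simp add: scaleR_unitization_def norm_scaleC)
  show "norm u = 0 \<longleftrightarrow> u = 0"
  proof
    assume "norm u = 0"
    then show "u = 0"
      using norm_alg_part_le[of u] norm_scalar_part_le[of u]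
      by (simp add: zero_unitization_def unitization.expand)
  next
    assume "u = 0"
    then show "norm u = 0"
      using norm_scaleC[of 0] by simp
  qed
  have "onorm (left_action (u + v)) \<le> onorm (left_action u) + onorm (left_action v)"
    unfolding left_action_plus
    by (rule onorm_triangle) (rule bounded_linear_left_action)+
  moreover have "cmod (scalar_part (u + v)) \<le> cmod (scalar_part u) + cmod (scalar_part v)"
    by (simp add: norm_triangle_ineq)
  ultimately show "norm (u + v) \<le> norm u + norm v"
    unfolding norm_unitization_def by linarith
  have "onorm (left_action (u * v)) \<le> onorm (left_action u) * onorm (left_action v)"
    unfolding left_action_times by (rule onorm_compose) (rule bounded_linear_left_action)+
  also have "\<dots> \<le> norm u * norm v"
    by (rule mult_mono) (auto simp: norm_unitization_def onorm_left_action_nonneg le_max_iff_disj)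
  finally have "onorm (left_action (u * v)) \<le> norm u * norm v" .
  moreover have "cmod (scalar_part (u * v)) \<le> norm u * norm v"
    using norm_scalar_part_le[of u] norm_scalar_part_le[of v]
    by (simp add: norm_mult mult_mono')
  ultimately show "norm (u * v) \<le> norm u * norm v"
    by (simp add: norm_unitization_def[of "u * v"])
qed

end

instance unitization :: (cstar_algebra) cstar_algebra
proof
  fix r :: real and c :: complex and u :: "'a unitization"
  show "r *\<^sub>R u = complex_of_real r *\<^sub>C u"
    by (rule scaleR_unitization_def)
  show "norm (c *\<^sub>C u) = cmod c * norm u"
    by (simp add: norm_unitization_def onorm_left_action_scaleC norm_mult
        max_mult_distrib_left)
  have "cmod (scalar_part (star u * u)) = (cmod (scalar_part u))\<^sup>2"
    by (simp add: norm_mult power2_eq_square)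
  \<comment> \<open>The maximum of two seminorms with the C*-identity has it too, because squaring
    is monotone on nonnegative numbers.\<close>
  then show "norm (star u * u) = (norm u)\<^sup>2"
    using onorm_left_action_nonneg[of u]
    by (simp add: norm_unitization_def onorm_left_action_cstar max_def power_mono_iff)
next
  fix X :: "nat \<Rightarrow> 'a unitization"
  assume X: "Cauchy X"
  have "Cauchy (\<lambda>n. alg_part (X n))"
  proof (rule metric_CauchyI)
    fix e :: real assume "0 < e"
    then obtain M where M: "dist (X m) (X n) < e / 2" if "m \<ge> M" "n \<ge> M" for m n
      using metric_CauchyD[OF X, of "e / 2"] by auto
    have "dist (alg_part (X m)) (alg_part (X n)) < e" if "m \<ge> M" "n \<ge> M" for m n
      using M[OF that] norm_alg_part_le[of "X m - X n"] by (simp add: dist_norm)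
    then show "\<exists>M. \<forall>m\<ge>M. \<forall>n\<ge>M. dist (alg_part (X m)) (alg_part (X n)) < e" by blast
  qed
  then obtain a where a: "(\<lambda>n. alg_part (X n)) \<longlonglongrightarrow> a"
    by (auto simp: Cauchy_convergent_iff convergent_def)
  have "Cauchy (\<lambda>n. scalar_part (X n))"
  proof (rule metric_CauchyI)
    fix e :: real assume "0 < e"
    then obtain M where M: "dist (X m) (X n) < e" if "m \<ge> M" "n \<ge> M" for m n
      using metric_CauchyD[OF X] by blast
    have "dist (scalar_part (X m)) (scalar_part (X n)) < e" if "m \<ge> M" "n \<ge> M" for m n
      using M[OF that] norm_scalar_part_le[of "X m - X n"] by (simp add: dist_norm)
    then show "\<exists>M. \<forall>m\<ge>M. \<forall>n\<ge>M. dist (scalar_part (X m)) (scalar_part (X n)) < e" by blast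
  qed
  then obtain c where c: "(\<lambda>n. scalar_part (X n)) \<longlonglongrightarrow> c"
    by (auto simp: Cauchy_convergent_iff convergent_def)
  have "(\<lambda>n. norm (alg_part (X n) - a) + cmod (scalar_part (X n) - c)) \<longlonglongrightarrow> 0"
    using tendsto_add[OF tendsto_norm_zero[OF LIM_zero[OF a]] tendsto_norm_zero[OF LIM_zero[OF c]]]
    by simp
  then have "(\<lambda>n. dist (X n) (Unitization a c)) \<longlonglongrightarrow> 0"
  proof (rule tendsto_sandwich[OF _ _ tendsto_const, rotated 2])
    show "\<forall>\<^sub>F n in sequentially. 0 \<le> dist (X n) (Unitization a c)"
      by simp
    show "\<forall>\<^sub>F n in sequentially. dist (X n) (Unitization a c)
        \<le> norm (alg_part (X n) - a) + cmod (scalar_part (X n) - c)"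
    proof (intro always_eventually allI)
      fix n
      show "dist (X n) (Unitization a c)
          \<le> norm (alg_part (X n) - a) + cmod (scalar_part (X n) - c)"
        using norm_unitization_le[of "X n - Unitization a c"] by (simp add: dist_norm)
    qed
  qed
  then have "X \<longlonglongrightarrow> Unitization a c"
    using tendsto_dist_iff by blast
  then show "convergent X" by (auto simp: convergent_def)
qed

section \<open>Unit of the unitization and embedding of the algebra\<close>

lemma is_unity_unitization: "is_unity (Unitization 0 1 :: 'a::complex_star_algebra unitization)"
  by (simp add: is_unity_def times_unitization_def unitization.expand scaleC_one)

text \<open>The lower bound comes from the action on \<open>star a\<close>. Being isometric, the
  embedding brings norm comparisons back from the unitization.\<close>

lemma norm_Unitization_zero: "norm (Unitization a 0) = norm (a::'a::cstar_algebra)"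
proof (rule antisym)
  show "norm (Unitization a 0) \<le> norm a"
    using norm_unitization_le[of "Unitization a 0"] by simp
  have "norm a * norm a = norm (left_action (Unitization a 0) (star a))"
    using cstar_identity[of "star a"]
    by (simp add: left_action_def star_star norm_star power2_eq_square)
  also have "\<dots> \<le> norm (Unitization a 0) * norm a"
    using norm_left_action_le[of "Unitization a 0" "star a"]
    by (simp add: norm_star norm_unitization_def onorm_left_action_nonneg max_absorb1)
  finally show "norm a \<le> norm (Unitization a 0)"
    by (cases "norm a = 0") auto
qed

section \<open>Spectra in unital C*-algebras\<close>

text \<open>Fixed points replace power series: any closed condition preserved by \<open>F\<close>,
  such as self-adjointness or commutation, can be put into \<open>S\<close> and so passes to the
  solution.\<close>

lemma contraction_fixed_point:
  fixes x :: "'a::cstar_algebra" and F :: "'a \<Rightarrow> 'a"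
  assumes "closed S" "S \<noteq> {}" "0 \<le> c" "c < 1"
    and "\<And>y. y \<in> S \<Longrightarrow> F y \<in> S"
    and "\<And>y z. y \<in> S \<Longrightarrow> z \<in> S \<Longrightarrow> norm (F y - F z) \<le> c * norm (y - z)"
  obtains y where "y \<in> S" "F y = y"
  using Banach_fix[of S c F] assms by (auto simp: complete_eq_closed dist_norm image_subset_iff)

lemma closed_commutant: "closed {y::'a::real_normed_algebra. \<forall>z\<in>Z. z * y = y * z}"
  unfolding Collect_ball_eq
  by (intro closed_INT ballI closed_Collect_eq continuous_intros)

text \<open>The unit is a parameter because the class does not provide one; thus the locale fits
  both a unital algebra and a unitization. The zero algebra, with \<open>\<one> = 0\<close>, is
  included.\<close>

locale unital_cstar_algebra =
  fixes one :: "'a::cstar_algebra"  ("\<one>")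
  assumes is_unity: "is_unity \<one>"
begin

lemma one_mult [simp]: "\<one> * x = x" and mult_one [simp]: "x * \<one> = x"
  using is_unity by (auto simp: is_unity_def)

lemma unity_one [simp]: "unity = \<one>"
  by (rule unity_eq[OF is_unity])

lemma star_one [simp]: "star \<one> = \<one>"
  by (rule is_unity_star[OF is_unity])

text \<open>Equality fails exactly in the zero algebra.\<close>

lemma norm_one_le: "norm \<one> \<le> 1"
proof -
  have "norm \<one> * norm \<one> = norm \<one>"
    using cstar_identity[of \<one>] by (simp add: power2_eq_square)
  then show ?thesis by auto
qed

section \<open>Inverses, perturbation and square roots\<close>

definition is_inverse :: "'a \<Rightarrow> 'a \<Rightarrow> bool"
  where "is_inverse x y \<longleftrightarrow> x * y = \<one> \<and> y * x = \<one>"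

lemma not_in_spectrum_iff: "z \<notin> spectrum (b::'a) \<longleftrightarrow> (\<exists>y. is_inverse (z *\<^sub>C \<one> - b) y)"
  by (auto simp: spectrum_def is_inverse_def)

lemma is_inverse_mult:
  assumes "is_inverse x y" "is_inverse x' y'"
  shows "is_inverse (x * x') (y' * y)"
proof -
  have "x * x' * (y' * y) = x * (x' * y') * y" "y' * y * (x * x') = y' * (y * x) * x'"
    by (simp_all add: mult.assoc)
  with assms show ?thesis by (simp add: is_inverse_def)
qed

lemma is_inverse_scaleC:
  assumes "is_inverse x y" "c \<noteq> 0"
  shows "is_inverse (c *\<^sub>C x) (inverse c *\<^sub>C y)"
  using assms
  by (simp add: is_inverse_def mult_scaleC_left mult_scaleC_right scaleC_scaleC scaleC_one)

lemma is_inverse_unique: "is_inverse x y \<Longrightarrow> is_inverse x z \<Longrightarrow> y = z"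
  unfolding is_inverse_def by (metis mult.assoc mult_one one_mult)

lemma is_inverse_star: "is_inverse x y \<Longrightarrow> is_inverse (star x) (star y)"
  unfolding is_inverse_def by (metis star_mult star_one)

lemma is_inverse_commutes:
  assumes "is_inverse x y" "x * z = z * x"
  shows "y * z = z * y"
proof -
  have "y * z = y * (z * x) * y"
    using assms(1) by (simp add: is_inverse_def mult.assoc)
  also have "\<dots> = z * y"
    using assms by (simp add: is_inverse_def flip: assms(2) mult.assoc)
  finally show ?thesis .
qed

lemma is_inverse_selfadjoint: "is_inverse x y \<Longrightarrow> star x = x \<Longrightarrow> star y = y"
  using is_inverse_star[of x y] is_inverse_unique[of x y "star y"] by simp

text \<open>The solution of v = y + y v is the sum of the powers y^k with k \<ge> 1, so 1 + v
  inverts 1 - y.\<close>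

lemma neumann_inverse:
  fixes y :: 'a
  assumes "norm y < 1"
  obtains d where "is_inverse (\<one> - y) d"
proof -
  \<comment> \<open>Commutation with \<open>y\<close>, built into the set, makes the inverse
    two-sided.\<close>
  let ?S = "{v. \<forall>w\<in>{y}. w * v = v * w}"
  obtain v where v: "v \<in> ?S" "y + y * v = v"
  proof (rule contraction_fixed_point[of ?S "norm y" "\<lambda>v. y + y * v"])
    show "closed ?S" by (rule closed_commutant)
    have "0 \<in> ?S" by simp
    then show "?S \<noteq> {}" by blast
    fix u v
    show "norm ((y + y * u) - (y + y * v)) \<le> norm y * norm (u - v)"
      using norm_mult_ineq[of y "u - v"] by (simp add: right_diff_distrib)
    show "y + y * u \<in> ?S" if "u \<in> ?S"
      using that by (simp add: distrib_left distrib_right) (metis mult.assoc)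
  qed (use assms in auto)
  then have "y * v = v * y" by simp
  with v(2) have "is_inverse (\<one> - y) (\<one> + v)"
    by (simp add: is_inverse_def distrib_left distrib_right left_diff_distrib right_diff_distrib
        diff_eq_eq)
  then show ?thesis by (rule that)
qed

text \<open>Write x - e = x (1 - y e). As \<parallel>y e\<parallel> \<le> 1/2, the inverse
  \<open>d\<close> of the second factor satisfies \<parallel>d\<parallel> \<le> 1 +
  \<parallel>d\<parallel>/2, whence the constant 2.\<close>

lemma perturbed_inverse:
  assumes "is_inverse x y" "norm e * norm y \<le> 1 / 2"
  obtains d where "is_inverse (x - e) d" "norm d \<le> 2 * norm y"
proof -
  have ye: "norm (y * e) \<le> 1 / 2"
    using assms(2) norm_mult_ineq[of y e] by (simp add: mult.commute)
  then have "norm (y * e) < 1" by simp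
  then obtain d where d: "is_inverse (\<one> - y * e) d"
    by (rule neumann_inverse)
  then have "d = \<one> + y * e * d"
    by (simp add: is_inverse_def left_diff_distrib diff_eq_eq)
  then have "norm d \<le> norm \<one> + norm (y * e * d)"
    by (metis norm_triangle_ineq)
  also have "\<dots> \<le> 1 + 1 / 2 * norm d"
    using norm_one_le norm_mult_ineq[of "y * e" d] mult_right_mono[OF ye norm_ge_zero[of d]]
    by linarith
  finally have "norm d \<le> 2" by simp
  have "x * (\<one> - y * e) = x - e"
    using assms(1) by (simp add: is_inverse_def right_diff_distrib flip: mult.assoc)
  then have "is_inverse (x - e) (d * y)"
    using is_inverse_mult[OF assms(1) d] by simp
  moreover have "norm (d * y) \<le> 2 * norm y"
    using norm_mult_ineq[of d y] mult_right_mono[OF \<open>norm d \<le> 2\<close> norm_ge_zero[of y]] by simp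
  ultimately show ?thesis by (rule that)
qed

text \<open>The root is \<open>1 - v\<close> for the fixed point \<open>v\<close> of \<open>v \<mapsto> (x + v\<^sup>2) / 2\<close>.\<close>

lemma sqrt_one_minus:
  fixes x :: 'a
  assumes "star x = x" "norm x < 1"
  obtains y where "star y = y" "y * y = \<one> - x" "\<forall>z. z * x = x * z \<longrightarrow> z * y = y * z"
proof -
  let ?F = "\<lambda>v. (1 / 2) *\<^sub>R (x + v * v)"
  \<comment> \<open>On this ball the map is a contraction with constant \<open>norm x\<close>. The
    other two conditions give a self-adjoint root that commutes with everything commuting with
    \<open>x\<close>.\<close>
  let ?S = "cball 0 (norm x) \<inter> {v. star v = v} \<inter> {v. \<forall>z\<in>{z. z * x = x * z}. z * v = v * z}"
  obtain v where v: "v \<in> ?S" "?F v = v"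
  proof (rule contraction_fixed_point[of ?S "norm x" ?F])
    show "closed ?S"
      by (intro closed_Int closed_commutant closed_cball closed_Collect_eq continuous_intros)
    have "0 \<in> ?S" by simp
    then show "?S \<noteq> {}" by blast
    fix u assume "u \<in> ?S"
    then have u: "norm u \<le> norm x" "star u = u" "\<forall>z. z * x = x * z \<longrightarrow> z * u = u * z"
      by auto
    have "norm (x + u * u) \<le> norm x + norm u * norm u"
      by (meson norm_triangle_ineq norm_mult_ineq add_left_mono order_trans)
    also have "\<dots> \<le> norm x + norm x * 1"
      using assms(2) u(1) by (intro add_mono mult_mono) auto
    finally have "norm (?F u) \<le> norm x" by simp
    moreover have "star (?F u) = ?F u"
      using assms(1) u(2) by (simp add: star_scaleR star_add star_mult)
    moreover have "z * ?F u = ?F u * z" if "z * x = x * z" for z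
    proof -
      have "z * u = u * z" using that u(3) by blast
      then have "z * (u * u) = u * u * z" by (metis mult.assoc)
      with that show ?thesis by (simp add: distrib_left distrib_right)
    qed
    ultimately show "?F u \<in> ?S" by simp
  next
    fix u w assume uw: "u \<in> ?S" "w \<in> ?S"
    have "u * u - w * w = u * (u - w) + (u - w) * w"
      by (simp add: algebra_simps)
    then have "norm (u * u - w * w) \<le> norm u * norm (u - w) + norm (u - w) * norm w"
      using norm_triangle_ineq[of "u * (u - w)" "(u - w) * w"] norm_mult_ineq[of u "u - w"]
        norm_mult_ineq[of "u - w" w] by simp
    also have "\<dots> \<le> norm x * norm (u - w) + norm (u - w) * norm x"
      using uw by (intro add_mono mult_mono) auto
    finally have "norm (u * u - w * w) \<le> 2 * (norm x * norm (u - w))" by simp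
    moreover have "?F u - ?F w = (1 / 2) *\<^sub>R (u * u - w * w)"
      by (simp flip: scaleR_diff_right)
    ultimately show "norm (?F u - ?F w) \<le> norm x * norm (u - w)" by simp
  next
    fix v assume "v \<in> ?S" "?F v = v"
    then show thesis by (rule that)
  qed (rule norm_ge_zero, rule assms(2))
  have v': "star v = v" "\<forall>z. z * x = x * z \<longrightarrow> z * v = v * z"
    using v(1) by blast+
  have "x + v * v = 2 *\<^sub>R v"
    using arg_cong[OF v(2), of "scaleR 2"] by simp
  then have "x + v * v = v + v" by (simp add: scaleR_2)
  then have "(\<one> - v) * (\<one> - v) = \<one> - x"
    by (simp add: algebra_simps)
  moreover have "star (\<one> - v) = \<one> - v"
    using v'(1) by (simp add: star_diff)
  moreover have "z * (\<one> - v) = (\<one> - v) * z" if "z * x = x * z" for z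
  proof -
    have "z * v = v * z" using v'(2) that by blast
    then show ?thesis by (simp add: algebra_simps)
  qed
  ultimately show ?thesis using that by blast
qed

text \<open>\<open>a + \<i>t\<close> is \<open>\<surd>\<lambda>\<close> times a unitary.\<close>

lemma norm_le_of_sum_squares:
  fixes a t :: 'a
  assumes "star a = a" "star t = t" "a * t = t * a"
    and sum: "a * a + t * t = complex_of_real l *\<^sub>C \<one>" and "0 \<le> l"
  shows "(norm a)\<^sup>2 \<le> l"
proof -
  let ?u = "a + \<i> *\<^sub>C t"
  have u': "star ?u = a - \<i> *\<^sub>C t"
    using assms by (simp add: star_add star_scaleC)
  have "star ?u * ?u = a * a + t * t"
    unfolding u' using assms(3)
    by (simp add: algebra_simps mult_scaleC_left mult_scaleC_right scaleC_scaleC scaleC_one)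
  then have "(norm ?u)\<^sup>2 = l * norm \<one>"
    using cstar_identity[of ?u] sum \<open>0 \<le> l\<close> by (simp add: norm_scaleC)
  also have "\<dots> \<le> l"
    using norm_one_le \<open>0 \<le> l\<close> by (simp add: mult_left_le)
  finally have ul: "(norm ?u)\<^sup>2 \<le> l" .
  have "2 *\<^sub>R a = ?u + star ?u" by (simp add: u' scaleR_2)
  then have "norm (2 *\<^sub>R a) \<le> norm ?u + norm (star ?u)"
    using norm_triangle_ineq[of ?u "star ?u"] by simp
  then have "norm a \<le> norm ?u" by (simp add: norm_star)
  then have "(norm a)\<^sup>2 \<le> (norm ?u)\<^sup>2" by (rule power_mono) simp
  then show ?thesis using ul by linarith
qed

text \<open>
  Elementary replacement for the spectral radius formula. If \<open>N - a\<^sup>2\<close> were invertible for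
  \<open>N = \<parallel>a\<parallel>\<^sup>2\<close>, then the inverses of \<open>l - a\<^sup>2\<close> would stay bounded as \<open>l\<close> decreases to \<open>N\<close>, so that the
  square root of \<open>l - a\<^sup>2\<close> could be corrected to one of \<open>l - \<delta> - a\<^sup>2\<close> with a fixed \<open>\<delta>\<close>; then
  \<open>\<parallel>a\<parallel>\<^sup>2 \<le> l - \<delta>\<close>.
\<close>

lemma norm_in_spectrum:
  fixes a :: 'a
  assumes a: "star a = a" and "a \<noteq> 0"
  shows "complex_of_real (norm a) \<in> spectrum a \<or> complex_of_real (- norm a) \<in> spectrum a"
proof (rule ccontr)
  define N where "N = (norm a)\<^sup>2"
  let ?h = "a * a" and ?k = "complex_of_real (norm a)"
  have N: "0 < N" "norm ?h = N"
    using \<open>a \<noteq> 0\<close> cstar_identity[of a] by (simp_all add: N_def a)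
  have h: "star ?h = ?h" by (simp add: star_mult a)
  assume "\<not> ?thesis"
  then obtain c1 c2 where c: "is_inverse (?k *\<^sub>C \<one> - a) c1" "is_inverse (- ?k *\<^sub>C \<one> - a) c2"
    by (auto simp: not_in_spectrum_iff)
  \<comment> \<open>If neither sign of \<open>norm a\<close> is in the spectrum, the product of the
    two factors shows that N - a^2 is invertible.\<close>
  have "(?k *\<^sub>C \<one> - a) * (- ?k *\<^sub>C \<one> - a) = - (complex_of_real N *\<^sub>C \<one> - ?h)"
    by (simp add: algebra_simps mult_scaleC_left mult_scaleC_right scaleC_scaleC N_def
        power2_eq_square)
  then have "is_inverse (- (complex_of_real N *\<^sub>C \<one> - ?h)) (c2 * c1)"
    using is_inverse_mult[OF c] by simp
  then have "is_inverse ((-1) *\<^sub>C (- (complex_of_real N *\<^sub>C \<one> - ?h))) (inverse (-1) *\<^sub>C (c2 * c1))"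
    by (rule is_inverse_scaleC) simp
  then obtain y where y: "is_inverse (complex_of_real N *\<^sub>C \<one> - ?h) y"
    by (auto simp: scaleC_one)
  \<comment> \<open>The summand \<open>4 * norm y\<close> makes \<open>\<delta>\<close> small
    against the inverse, \<open>1 / N\<close> ensures \<open>\<delta> \<le> N\<close>, and 1 makes
    the first bound strict.\<close>
  define \<delta> where "\<delta> = 1 / (4 * norm y + 1 + 1 / N)"
  have D: "0 < 4 * norm y + 1 + 1 / N"
    using norm_ge_zero[of y] divide_pos_pos[OF zero_less_one N(1)] by linarith
  then have \<delta>: "0 < \<delta>" by (simp add: \<delta>_def)
  have "4 * norm y < 4 * norm y + 1 + 1 / N"
    using divide_pos_pos[OF zero_less_one N(1)] by linarith
  then have \<delta>y: "4 * norm y * \<delta> < 1"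
    using D by (simp add: \<delta>_def)
  have "1 / N \<le> 4 * norm y + 1 + 1 / N" by simp
  then have \<delta>N: "\<delta> \<le> N"
    using N(1) D by (simp add: \<delta>_def field_simps)
  \<comment> \<open>Half of \<open>\<delta>\<close> puts \<open>l\<close> above \<open>N\<close>, so
    that a^2 / l has norm below 1, while \<open>l - \<delta>\<close> is below
    \<open>N\<close>.\<close>
  define l where "l = N + \<delta> / 2"
  let ?l = "complex_of_real l"
  have l: "N < l" "0 < l" using \<delta> N(1) by (simp_all add: l_def)
  have "norm (complex_of_real (- \<delta> / 2) *\<^sub>C \<one>) * norm y \<le> \<delta> / 2 * 1 * norm y"
    using norm_one_le \<delta> by (intro mult_right_mono) (simp_all add: norm_scaleC)
  also have "\<dots> \<le> 1 / 2" using \<delta>y by (simp add: mult.commute)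
  finally obtain d where d: "is_inverse (?l *\<^sub>C \<one> - ?h) d" "norm d \<le> 2 * norm y"
    using perturbed_inverse[OF y, of "complex_of_real (- \<delta> / 2) *\<^sub>C \<one>"]
    by (auto simp: l_def algebra_simps scaleC_add_left)
  have ah: "a * ?h = ?h * a" by (simp add: mult.assoc)
  let ?g = "(1 / ?l) *\<^sub>C ?h"
  have "star ?g = ?g" "norm ?g < 1"
    using l N by (simp_all add: star_scaleC h norm_scaleC norm_divide)
  then obtain s where s: "star s = s" "s * s = \<one> - ?g"
    and s_comm: "\<forall>z. z * ?g = ?g * z \<longrightarrow> z * s = s * z"
    by (rule sqrt_one_minus)
  have as: "a * s = s * a"
    by (rule s_comm[rule_format]) (simp add: mult_scaleC_left mult_scaleC_right ah)
  have sd: "star d = d"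
    by (rule is_inverse_selfadjoint[OF d(1)]) (simp add: star_diff star_scaleC h)
  have "norm (complex_of_real \<delta> *\<^sub>C d) \<le> \<delta> * (2 * norm y)"
    using d(2) \<delta> by (simp add: norm_scaleC)
  also have "\<dots> < 1" using \<delta>y \<delta> by (simp add: algebra_simps)
  finally have d_small: "norm (complex_of_real \<delta> *\<^sub>C d) < 1" .
  have "star (complex_of_real \<delta> *\<^sub>C d) = complex_of_real \<delta> *\<^sub>C d"
    by (simp add: star_scaleC sd)
  then obtain w where w: "star w = w" "w * w = \<one> - complex_of_real \<delta> *\<^sub>C d"
    "\<forall>z. z * (complex_of_real \<delta> *\<^sub>C d) = (complex_of_real \<delta> *\<^sub>C d) * z \<longrightarrow> z * w = w * z"
    using d_small by (rule sqrt_one_minus)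
  have dw: "z * w = w * z" if z: "z * ?h = ?h * z" for z
  proof -
    have "(?l *\<^sub>C \<one> - ?h) * z = z * (?l *\<^sub>C \<one> - ?h)"
      unfolding left_diff_distrib right_diff_distrib z
      by (simp add: mult_scaleC_left mult_scaleC_right)
    then have "d * z = z * d" by (rule is_inverse_commutes[OF d(1)])
    then show ?thesis
      by (intro w(3)[rule_format]) (simp add: mult_scaleC_left mult_scaleC_right)
  qed
  have "s * ?h = ?h * s" using as by (metis mult.assoc)
  then have sw: "s * w = w * s" and aw: "a * w = w * a" by (auto intro: dw ah)
  \<comment> \<open>Here s^2 = 1 - a^2/l and w^2 = 1 - \<delta> d with \<open>d\<close> the inverse
    of l - a^2, so \<open>?t\<close> has the square (l - a^2) (1 - \<delta> d) = l - \<delta> -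
    a^2.\<close>
  let ?t = "complex_of_real (sqrt l) *\<^sub>C (s * w)"
  have "s * w * (s * w) = (s * s) * (w * w)"
    using sw by (metis mult.assoc)
  moreover have "complex_of_real (sqrt l) * complex_of_real (sqrt l) = ?l"
    using l by (simp flip: of_real_mult)
  ultimately have "?t * ?t = ?l *\<^sub>C (s * s) * (w * w)"
    by (simp add: mult_scaleC_left mult_scaleC_right scaleC_scaleC)
  also have "?l *\<^sub>C (s * s) = ?l *\<^sub>C \<one> - ?h"
    using l by (simp add: s(2) scaleC.scale_right_diff_distrib scaleC_scaleC scaleC_one)
  also have "\<dots> * (w * w) = ?l *\<^sub>C \<one> - ?h - complex_of_real \<delta> *\<^sub>C \<one>"
    using d(1) unfolding w(2) right_diff_distrib mult_scaleC_right by (simp add: is_inverse_def)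
  finally have "?h + ?t * ?t = complex_of_real (l - \<delta>) *\<^sub>C \<one>"
    by (simp add: scaleC.scale_left_diff_distrib)
  moreover have "star ?t = ?t"
    by (simp add: star_scaleC star_mult s(1) w(1) sw)
  moreover have "a * ?t = ?t * a"
    using as aw by (simp add: mult_scaleC_left mult_scaleC_right) (metis mult.assoc)
  ultimately have "(norm a)\<^sup>2 \<le> l - \<delta>"
    using \<delta>N \<delta> by (intro norm_le_of_sum_squares[OF a]) (auto simp: l_def)
  then show False using \<delta> by (simp add: N_def l_def)
qed

section \<open>Compactness and reality of the spectrum\<close>

lemma spectrum_bounded:
  fixes b :: 'a
  assumes "z \<in> spectrum b"
  shows "cmod z \<le> norm b"
proof (rule ccontr)
  assume "\<not> ?thesis"
  then have z: "norm b < cmod z" "z \<noteq> 0" using norm_ge_zero[of b] by auto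
  let ?y = "(1 / z) *\<^sub>C b"
  have ny: "norm ?y < 1"
    using z by (simp add: norm_scaleC norm_divide)
  then obtain d where "is_inverse (\<one> - ?y) d"
    by (rule neumann_inverse)
  then have "is_inverse (z *\<^sub>C (\<one> - ?y)) (inverse z *\<^sub>C d)"
    using z(2) by (rule is_inverse_scaleC)
  moreover have "z *\<^sub>C (\<one> - ?y) = z *\<^sub>C \<one> - b"
    using z(2) by (simp add: scaleC.scale_right_diff_distrib scaleC_scaleC scaleC_one)
  ultimately show False
    using assms not_in_spectrum_iff by metis
qed

lemma closed_spectrum: "closed (spectrum (b::'a))"
proof -
  have "open (- spectrum b)"
    unfolding open_contains_ball
  proof
    fix z assume "z \<in> - spectrum b"
    then obtain y where y: "is_inverse (z *\<^sub>C \<one> - b) y"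
      by (auto simp: not_in_spectrum_iff)
    \<comment> \<open>The radius brings shifts of \<open>z\<close> within reach of
      \<open>perturbed_inverse\<close>. Adding 1 covers y = 0, where the quotient would otherwise
      take the default value 0.\<close>
    define e where "e = 1 / (2 * (norm y + 1))"
    have "0 < 2 * (norm y + 1)"
      by (simp add: add_nonneg_pos)
    then have e: "0 < e" "e * norm y \<le> 1 / 2"
      by (simp_all add: e_def field_simps)
    have "z' \<in> - spectrum b" if "z' \<in> ball z e" for z'
    proof -
      have "norm ((z - z') *\<^sub>C \<one>) * norm y \<le> (e * 1) * norm y"
        using that norm_one_le
        unfolding norm_scaleC using e(1) by (intro mult_right_mono mult_mono) (auto simp: dist_norm)
      then have "norm ((z - z') *\<^sub>C \<one>) * norm y \<le> 1 / 2" using e by simp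
      then obtain d where "is_inverse (z *\<^sub>C \<one> - b - (z - z') *\<^sub>C \<one>) d"
        using perturbed_inverse[OF y] by blast
      then show ?thesis
        by (auto simp: not_in_spectrum_iff scaleC.scale_left_diff_distrib)
    qed
    with e(1) show "\<exists>e>0. ball z e \<subseteq> - spectrum b" by blast
  qed
  then show ?thesis by (simp add: closed_def)
qed

lemma compact_spectrum: "compact (spectrum (b::'a))"
  using closed_spectrum[of b] spectrum_bounded[of _ b]
  by (auto simp: compact_eq_bounded_closed bounded_iff)

text \<open>Shift \<open>b\<close> by i l with \<open>l\<close> real: the spectral point becomes z +
  i l, while \<parallel>b + i l\<parallel>^2 \<le> \<parallel>b\<parallel>^2 + l^2. The squares of
  \<open>l\<close> cancel and leave a bound linear in \<open>l\<close>, which can hold for all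
  \<open>l\<close> only if Im z = 0.\<close>

lemma spectrum_real:
  fixes b :: 'a
  assumes "star b = b" "z \<in> spectrum b"
  shows "z = complex_of_real (Re z)"
proof (rule ccontr)
  assume "\<not> ?thesis"
  then have y: "Im z \<noteq> 0" by (auto simp: complex_eq_iff)
  have bound: "(Im z)\<^sup>2 + 2 * Im z * l \<le> (norm b)\<^sup>2" for l
  proof -
    let ?c = "\<i> * complex_of_real l"
    let ?v = "b + ?c *\<^sub>C \<one>"
    have ii: "?c * ?c = - complex_of_real (l\<^sup>2)"
      by (simp add: power2_eq_square algebra_simps)
    have "(z + ?c) *\<^sub>C \<one> - ?v = z *\<^sub>C \<one> - b"
      by (simp add: scaleC_add_left)
    then have "z + ?c \<in> spectrum ?v"
      using assms(2) not_in_spectrum_iff by metis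
    then have "(cmod (z + ?c))\<^sup>2 \<le> (norm ?v)\<^sup>2"
      by (intro power_mono spectrum_bounded) auto
    also have "\<dots> = norm (star ?v * ?v)"
      by (simp add: cstar_identity)
    also have "star ?v * ?v = b * b + complex_of_real (l\<^sup>2) *\<^sub>C \<one>"
      by (simp add: star_add star_scaleC assms(1) distrib_left distrib_right mult_scaleC_left
          left_diff_distrib mult_scaleC_right scaleC_scaleC scaleC.scale_right_diff_distrib ii)
    also have "norm \<dots> \<le> norm (b * b) + l\<^sup>2 * norm \<one>"
      by (rule order_trans[OF norm_triangle_ineq]) (simp add: norm_scaleC norm_power)
    also have "\<dots> \<le> (norm b)\<^sup>2 + l\<^sup>2"
      using cstar_identity[of b] norm_one_le assms(1) by (simp add: mult_left_le)
    finally have "(Re z)\<^sup>2 + ((Im z)\<^sup>2 + 2 * Im z * l) \<le> (norm b)\<^sup>2"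
      by (simp add: cmod_power2 power2_sum)
    then show ?thesis using zero_le_power2[of "Re z"] by linarith
  qed
  \<comment> \<open>This value of \<open>l\<close> makes the linear term equal to
    \<parallel>b\<parallel>^2 + 1.\<close>
  have "(Im z)\<^sup>2 + 2 * Im z * (((norm b)\<^sup>2 + 1) / (2 * Im z)) \<le> (norm b)\<^sup>2"
    by (rule bound)
  moreover have "2 * Im z * (((norm b)\<^sup>2 + 1) / (2 * Im z)) = (norm b)\<^sup>2 + 1"
    using y by simp
  ultimately have "(Im z)\<^sup>2 + 1 \<le> 0" by linarith
  then show False by (metis add_nonneg_pos not_less zero_le_power2 zero_less_one)
qed

end

section \<open>Continuous functional calculus of self-adjoint elements\<close>

text \<open>Since \<open>S\<close> is real, the Weierstrass theorem applies to real and imaginary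
  parts separately, and polynomials in z suffice without its conjugate.\<close>

lemma uniform_polynomial_approximation:
  fixes f :: "complex \<Rightarrow> complex"
  assumes S: "compact S" "\<And>z. z \<in> S \<Longrightarrow> z = complex_of_real (Re z)"
    and f: "continuous_on S f"
  obtains Q :: "nat \<Rightarrow> complex poly" where "uniform_limit S (\<lambda>n. poly (Q n)) f sequentially"
proof -
  let ?T = "Re ` S"
  have T: "compact ?T"
    by (intro compact_continuous_image continuous_intros S(1))
  have "complex_of_real ` ?T = S"
    using S(2) by force
  then have f_T: "continuous_on ?T (\<lambda>t. f (complex_of_real t))"
    by (intro continuous_on_compose2[OF f]) (auto intro!: continuous_intros)
  have poly_of_real: "\<exists>q. \<forall>x. poly q (complex_of_real x) = complex_of_real (g x)"
    if g: "real_polynomial_function g" for g :: "real \<Rightarrow> real"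
  proof -
    obtain a n where "g = (\<lambda>x. \<Sum>i\<le>n. a i * x ^ i)"
      using g unfolding real_polynomial_function_iff_sum by blast
    then show ?thesis
      by (intro exI[of _ "\<Sum>i\<le>n. monom (complex_of_real (a i)) i"]) (simp add: poly_sum poly_monom)
  qed
  have "\<exists>q. \<forall>z\<in>S. dist (poly q z) (f z) < e" if e: "0 < e" for e
  proof -
    have re: "continuous_on ?T (\<lambda>t. Re (f (complex_of_real t)))"
      and im: "continuous_on ?T (\<lambda>t. Im (f (complex_of_real t)))"
      by (intro continuous_intros f_T)+
    obtain g where g: "real_polynomial_function g"
      "\<forall>x\<in>?T. \<bar>Re (f (complex_of_real x)) - g x\<bar> < e / 2"
      by (rule Stone_Weierstrass_real_polynomial_function[OF T re half_gt_zero[OF e]]) (auto intro!: that)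
    obtain h where h: "real_polynomial_function h"
      "\<forall>x\<in>?T. \<bar>Im (f (complex_of_real x)) - h x\<bar> < e / 2"
      by (rule Stone_Weierstrass_real_polynomial_function[OF T im half_gt_zero[OF e]]) (auto intro!: that)
    obtain q r where q: "\<And>x. poly q (complex_of_real x) = complex_of_real (g x)"
      and r: "\<And>x. poly r (complex_of_real x) = complex_of_real (h x)"
      using poly_of_real[OF g(1)] poly_of_real[OF h(1)] by auto
    have "dist (poly (q + smult \<i> r) z) (f z) < e" if "z \<in> S" for z
    proof -
      let ?x = "Re z"
      have z: "z = complex_of_real ?x" by (rule S(2)[OF that])
      have p: "poly (q + smult \<i> r) z = Complex (g ?x) (h ?x)"
        using q[of ?x] r[of ?x] by (simp flip: z) (simp add: complex_eq_iff)
      have fz: "f (complex_of_real ?x) = f z" by (simp flip: z)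
      have "cmod (poly (q + smult \<i> r) z - f z) \<le> \<bar>g ?x - Re (f z)\<bar> + \<bar>h ?x - Im (f z)\<bar>"
        unfolding p using cmod_le[of "Complex (g ?x) (h ?x) - f z"] by simp
      also have "\<dots> < e"
        using bspec[OF g(2) imageI[OF that]] bspec[OF h(2) imageI[OF that]] unfolding fz
        by linarith
      finally show ?thesis by (simp add: dist_norm)
    qed
    then show ?thesis by blast
  qed
  then have "\<forall>n. \<exists>q. \<forall>z\<in>S. dist (poly q z) (f z) < inverse (real (Suc n))"
    by (intro allI) simp
  then obtain Q where Q: "\<And>n z. z \<in> S \<Longrightarrow> dist (poly (Q n) z) (f z) < inverse (real (Suc n))"
    by metis
  have "uniform_limit S (\<lambda>n. poly (Q n)) f sequentially"
  proof (rule uniform_limitI)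
    fix e :: real assume "0 < e"
    then have "\<forall>\<^sub>F n in sequentially. inverse (real (Suc n)) < e"
      using LIMSEQ_inverse_real_of_nat order_tendstoD(2) by blast
    then show "\<forall>\<^sub>F n in sequentially. \<forall>z\<in>S. dist (poly (Q n) z) (f z) < e"
      by (rule eventually_mono) (use Q less_trans in blast)
  qed
  then show ?thesis by (rule that)
qed

section \<open>Polynomial functional calculus\<close>

context unital_cstar_algebra
begin

text \<open>Horner's scheme with complex coefficients and an argument in the algebra; constants
  enter as multiples of the unit.\<close>

definition poly_eval :: "'a \<Rightarrow> complex poly \<Rightarrow> 'a"
  where "poly_eval b q = fold_coeffs (\<lambda>c x. c *\<^sub>C \<one> + b * x) q 0"

lemma poly_eval_0 [simp]: "poly_eval b 0 = 0"
  by (simp add: poly_eval_def)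

lemma poly_eval_pCons [simp]: "poly_eval b (pCons c q) = c *\<^sub>C \<one> + b * poly_eval b q"
  by (cases "c = 0 \<and> q = 0") (auto simp: poly_eval_def fold_coeffs_pCons_coeff_not_0_eq
      fold_coeffs_pCons_not_0_0_eq)

lemma poly_eval_add: "poly_eval b (q + r) = poly_eval b q + poly_eval b r"
  by (induct q r rule: poly_induct2) (simp_all add: scaleC_add_left algebra_simps)

lemma poly_eval_smult: "poly_eval b (smult c q) = c *\<^sub>C poly_eval b q"
  by (induct q) (simp_all add: scaleC_add_right scaleC_scaleC mult_scaleC_right)

lemma poly_eval_diff: "poly_eval b (q - r) = poly_eval b q - poly_eval b r"
  using poly_eval_add[of b "q - r" r] by simp

lemma poly_eval_commutes: "poly_eval b q * b = b * poly_eval b q"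
  by (induct q) (simp_all add: distrib_left distrib_right mult_scaleC_left mult_scaleC_right
      mult.assoc)

lemma poly_eval_mult: "poly_eval b (q * r) = poly_eval b q * poly_eval b r"
  by (induct q) (simp_all add: poly_eval_add poly_eval_smult distrib_right mult_scaleC_left
      mult.assoc)

lemma poly_eval_star:
  assumes "star b = b"
  shows "star (poly_eval b q) = poly_eval b (map_poly cnj q)"
  by (induct q) (simp_all add: map_poly_pCons star_add star_scaleC star_mult assms
      poly_eval_commutes)

text \<open>Over the complex numbers \<open>q\<close> splits into linear factors; no root lies in
  the spectrum, so every factor is invertible at \<open>b\<close>.\<close>

lemma poly_eval_invertible:
  assumes "q \<noteq> 0" "\<And>z. z \<in> spectrum b \<Longrightarrow> poly q z \<noteq> 0"
  shows "\<exists>y. is_inverse (poly_eval b q) y"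
  using assms
proof (induct "degree q" arbitrary: q)
  case 0
  then obtain c where "q = [:c:]" "c \<noteq> 0"
    by (metis degree_eq_zeroE pCons_0_0)
  then show ?case
    using is_inverse_scaleC[of \<one> \<one> c] by (auto simp: is_inverse_def)
next
  case (Suc n)
  then have "\<not> constant (poly q)"
    by (simp add: constant_degree)
  then obtain z where z: "poly q z = 0"
    using fundamental_theorem_of_algebra by blast
  then obtain r where r: "q = [:- z, 1:] * r"
    by (metis poly_eq_0_iff_dvd dvdE)
  with Suc.prems(1) have "r \<noteq> 0" by auto
  moreover have "n = degree r"
    using Suc.hyps(2) \<open>r \<noteq> 0\<close> degree_mult_eq[of "[:- z, 1:]" r] by (simp add: r)
  moreover have "poly r w \<noteq> 0" if "w \<in> spectrum b" for w
    using Suc.prems(2)[OF that] by (auto simp: r)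
  ultimately obtain y where y: "is_inverse (poly_eval b r) y"
    using Suc.hyps(1) by blast
  have "z \<notin> spectrum b"
    using z Suc.prems(2) by blast
  then obtain x where "is_inverse (z *\<^sub>C \<one> - b) x"
    by (auto simp: not_in_spectrum_iff)
  then have "is_inverse ((-1) *\<^sub>C (z *\<^sub>C \<one> - b)) (inverse (-1) *\<^sub>C x)"
    by (rule is_inverse_scaleC) simp
  moreover have "(-1) *\<^sub>C (z *\<^sub>C \<one> - b) = poly_eval b [:- z, 1:]"
    by (simp add: scaleC_one)
  ultimately show ?case
    using is_inverse_mult[OF _ y] unfolding r poly_eval_mult by metis
qed

text \<open>For nonzero self-adjoint \<open>b\<close> a point is already exhibited by
  \<open>norm_in_spectrum\<close>, which avoids Liouville's theorem.\<close>

lemma spectrum_nonempty: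
  fixes b :: 'a
  assumes "star b = b" "\<one> \<noteq> 0"
  shows "spectrum b \<noteq> {}"
proof (cases "b = 0")
  case True
  have "\<not> is_inverse (0 *\<^sub>C \<one> - b) y" for y
    using assms(2) by (auto simp: True is_inverse_def)
  then have "0 \<in> spectrum b"
    using not_in_spectrum_iff by blast
  then show ?thesis by blast
qed (use norm_in_spectrum[OF assms(1)] in blast)

text \<open>One inclusion of the spectral mapping theorem: if z - q had no zero on the spectrum, z -
  q(b) would be invertible. If \<open>q\<close> is the constant \<open>z\<close>, any spectral point
  serves, provided there is one.\<close>

lemma spectrum_poly_eval:
  assumes "z \<in> spectrum (poly_eval b q)" "spectrum b \<noteq> {}"
  obtains w where "w \<in> spectrum b" "z = poly q w"
proof (cases "[:z:] - q = 0")
  case True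
  then have "q = [:z:]" by simp
  with assms(2) that show ?thesis by auto
next
  case False
  have "\<nexists>y. is_inverse (poly_eval b ([:z:] - q)) y"
    using assms(1) not_in_spectrum_iff[of z "poly_eval b q"] by (simp add: poly_eval_diff)
  then obtain w where "w \<in> spectrum b" "poly ([:z:] - q) w = 0"
    using poly_eval_invertible[OF False] by blast
  with that show ?thesis by simp
qed

lemma eq_0_of_one_eq_0: "\<one> = 0 \<Longrightarrow> x = (0::'a)"
  by (metis one_mult mult_zero_left)

text \<open>By the C*-identity it is enough to treat the self-adjoint element \<open>a\<close> that
  belongs to |q|^2. One of \<plusminus>\<parallel>a\<parallel> is in its spectrum, and spectral
  mapping writes that number as |q(w)|^2 with \<open>w\<close> real.\<close>

lemma norm_poly_eval_le:
  assumes b: "star b = b" and "0 \<le> M" and M: "\<And>z. z \<in> spectrum b \<Longrightarrow> cmod (poly q z) \<le> M"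
  shows "norm (poly_eval b q) \<le> M"
\<comment> \<open>In the zero algebra every spectrum is empty, so there is no spectral point to
  argue with.\<close>
proof (cases "\<one> = 0")
  case True
  then have "poly_eval b q = 0" by (rule eq_0_of_one_eq_0)
  with \<open>0 \<le> M\<close> show ?thesis by simp
next
  case False
  define a where "a = poly_eval b (map_poly cnj q * q)"
  have a_eq: "a = star (poly_eval b q) * poly_eval b q"
    by (simp add: a_def poly_eval_mult poly_eval_star[OF b])
  then have norm_a: "norm a = (norm (poly_eval b q))\<^sup>2"
    by (simp add: cstar_identity)
  show ?thesis
  proof (cases "a = 0")
    case True
    with norm_a \<open>0 \<le> M\<close> show ?thesis by simp
  next
    case False
    have "star a = a" by (simp add: a_eq)
    then obtain z where z: "z \<in> spectrum a" "cmod z = norm a"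
      using norm_in_spectrum[OF _ False] by fastforce
    then obtain w where w: "w \<in> spectrum b" "z = poly (map_poly cnj q * q) w"
      using spectrum_poly_eval[OF _ spectrum_nonempty[OF b \<open>\<one> \<noteq> 0\<close>]] unfolding a_def by metis
    have "cnj w = w"
      using spectrum_real[OF b w(1)] by (metis complex_cnj_complex_of_real)
    then have "cmod z = (cmod (poly q w))\<^sup>2"
      using poly_cnj[of q w] by (simp add: w(2) norm_mult power2_eq_square)
    then have "(norm (poly_eval b q))\<^sup>2 \<le> M\<^sup>2"
      using z(2) norm_a M[OF w(1)] by (simp add: power_mono)
    then show ?thesis using \<open>0 \<le> M\<close> by (rule power2_le_imp_le)
  qed
qed

section \<open>Continuous functional calculus as a limit of polynomials\<close>

definition cfc_limit :: "'a \<Rightarrow> (complex \<Rightarrow> complex) \<Rightarrow> 'a \<Rightarrow> bool"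
  where "cfc_limit b f y \<longleftrightarrow> (\<exists>Q. uniform_limit (spectrum b) (\<lambda>n. poly (Q n)) f sequentially \<and>
    (\<lambda>n. poly_eval b (Q n)) \<longlonglongrightarrow> y)"

lemma cfc_limit_poly: "cfc_limit b (poly q) (poly_eval b q)"
  unfolding cfc_limit_def
  by (rule exI[of _ "\<lambda>_. q"]) (auto intro: uniform_limit_const)

lemma cfc_limit_cong:
  "cfc_limit b f y \<Longrightarrow> (\<And>z. z \<in> spectrum b \<Longrightarrow> f z = g z) \<Longrightarrow> cfc_limit b g y"
  unfolding cfc_limit_def using uniform_limit_cong'[of "spectrum b" "\<lambda>n. poly (_ n)" _ f g] by metis

lemma cfc_limit_add:
  assumes "cfc_limit b f y" "cfc_limit b g z"
  shows "cfc_limit b (\<lambda>w. f w + g w) (y + z)"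
proof -
  from assms obtain Q R where
    "uniform_limit (spectrum b) (\<lambda>n. poly (Q n)) f sequentially" "(\<lambda>n. poly_eval b (Q n)) \<longlonglongrightarrow> y"
    "uniform_limit (spectrum b) (\<lambda>n. poly (R n)) g sequentially" "(\<lambda>n. poly_eval b (R n)) \<longlonglongrightarrow> z"
    by (auto simp: cfc_limit_def)
  then have "uniform_limit (spectrum b) (\<lambda>n w. poly (Q n) w + poly (R n) w) (\<lambda>w. f w + g w) sequentially"
      "(\<lambda>n. poly_eval b (Q n) + poly_eval b (R n)) \<longlonglongrightarrow> y + z"
    by (auto intro!: uniform_limit_add tendsto_add)
  moreover have "(\<lambda>n w. poly (Q n) w + poly (R n) w) = (\<lambda>n. poly (Q n + R n))"
    by (simp add: fun_eq_iff)
  ultimately show ?thesis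
    unfolding cfc_limit_def poly_eval_add[symmetric] by auto
qed

lemma cfc_limit_mult:
  assumes "cfc_limit b f y" "cfc_limit b g z"
    and "continuous_on (spectrum b) f" "continuous_on (spectrum b) g"
  shows "cfc_limit b (\<lambda>w. f w * g w) (y * z)"
proof -
  from assms obtain Q R where
    "uniform_limit (spectrum b) (\<lambda>n. poly (Q n)) f sequentially" "(\<lambda>n. poly_eval b (Q n)) \<longlonglongrightarrow> y"
    "uniform_limit (spectrum b) (\<lambda>n. poly (R n)) g sequentially" "(\<lambda>n. poly_eval b (R n)) \<longlonglongrightarrow> z"
    by (auto simp: cfc_limit_def)
  moreover have "bounded (f ` spectrum b)" "bounded (g ` spectrum b)"
    using assms(3,4) compact_spectrum by (auto intro: compact_imp_bounded compact_continuous_image)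
  ultimately have "uniform_limit (spectrum b) (\<lambda>n w. poly (Q n) w * poly (R n) w) (\<lambda>w. f w * g w) sequentially"
      "(\<lambda>n. poly_eval b (Q n) * poly_eval b (R n)) \<longlonglongrightarrow> y * z"
    by (auto intro!: uniform_lim_mult tendsto_mult)
  moreover have "(\<lambda>n w. poly (Q n) w * poly (R n) w) = (\<lambda>n. poly (Q n * R n))"
    by (simp add: fun_eq_iff)
  ultimately show ?thesis
    unfolding cfc_limit_def poly_eval_mult[symmetric] by auto
qed

lemma cfc_limit_scaleC:
  assumes "cfc_limit b f y" "continuous_on (spectrum b) f"
  shows "cfc_limit b (\<lambda>w. c * f w) (c *\<^sub>C y)"
  using cfc_limit_mult[OF cfc_limit_poly[of b "[:c:]"] assms(1) _ assms(2)]
  by (simp add: mult_scaleC_left)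

text \<open>On a real spectrum, conjugating the coefficients of a polynomial conjugates its
  values.\<close>

lemma cfc_limit_star:
  assumes "star b = b" "cfc_limit b f y"
  shows "cfc_limit b (\<lambda>w. cnj (f w)) (star y)"
proof -
  from assms(2) obtain Q where
    Q: "uniform_limit (spectrum b) (\<lambda>n. poly (Q n)) f sequentially"
    "(\<lambda>n. poly_eval b (Q n)) \<longlonglongrightarrow> y"
    by (auto simp: cfc_limit_def)
  have "poly (map_poly cnj q) w = cnj (poly q w)" if "w \<in> spectrum b" for q w
    using poly_cnj[of q w] spectrum_real[OF assms(1) that] by (metis complex_cnj_complex_of_real)
  then have "uniform_limit (spectrum b) (\<lambda>n. poly (map_poly cnj (Q n))) (\<lambda>w. cnj (f w)) sequentially"
    using Q(1) unfolding uniform_limit_iff dist_norm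
    by (simp flip: complex_cnj_diff)
  moreover have "(\<lambda>n. poly_eval b (map_poly cnj (Q n))) \<longlonglongrightarrow> star y"
    using tendsto_star[OF Q(2)] by (simp add: poly_eval_star[OF assms(1)])
  ultimately show ?thesis
    unfolding cfc_limit_def by (intro exI[of _ "\<lambda>n. map_poly cnj (Q n)"] conjI)
qed

lemma norm_cfc_limit_le:
  assumes b: "star b = b" and y: "cfc_limit b f y"
    and "0 \<le> M" and M: "\<And>z. z \<in> spectrum b \<Longrightarrow> cmod (f z) \<le> M"
  shows "norm y \<le> M"
proof (rule field_le_epsilon)
  fix e :: real assume "0 < e"
  obtain Q where Q: "uniform_limit (spectrum b) (\<lambda>n. poly (Q n)) f sequentially"
    "(\<lambda>n. poly_eval b (Q n)) \<longlonglongrightarrow> y"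
    using y by (auto simp: cfc_limit_def)
  have "\<forall>\<^sub>F n in sequentially. \<forall>z\<in>spectrum b. dist (poly (Q n) z) (f z) < e"
    using Q(1) \<open>0 < e\<close> by (rule uniform_limitD)
  then have "\<forall>\<^sub>F n in sequentially. norm (poly_eval b (Q n)) \<le> M + e"
  proof eventually_elim
    case (elim n)
    show ?case
    proof (rule norm_poly_eval_le[OF b])
      fix z assume z: "z \<in> spectrum b"
      show "cmod (poly (Q n) z) \<le> M + e"
        using bspec[OF elim z] M[OF z] norm_triangle_sub[of "poly (Q n) z" "f z"]
        by (simp add: dist_norm)
    qed (use \<open>0 \<le> M\<close> \<open>0 < e\<close> in simp)
  qed
  then show "norm y \<le> M + e"
    by (rule tendsto_upperbound[OF tendsto_norm[OF Q(2)]]) simp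
qed

text \<open>The difference of two values is a limit for the zero function, so
  \<open>norm_cfc_limit_le\<close> bounds its norm by 0.\<close>

lemma cfc_limit_unique:
  fixes b :: 'a
  assumes "star b = b" "cfc_limit b f y" "cfc_limit b f z"
    and "continuous_on (spectrum b) f"
  shows "y = z"
proof -
  have "cfc_limit b (\<lambda>w. f w + (-1) * f w) (y + (-1) *\<^sub>C z)"
    by (intro cfc_limit_add cfc_limit_scaleC assms)
  from norm_cfc_limit_le[OF assms(1) this, of 0] have "norm (y + (-1) *\<^sub>C z) \<le> 0"
    by simp
  then show ?thesis by (simp add: scaleC_one)
qed

text \<open>Evaluation at \<open>b\<close> is contractive for the supremum norm over the spectrum,
  so uniformly convergent polynomials give a Cauchy sequence.\<close>

lemma cfc_limit_exists:
  fixes b :: 'a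
  assumes b: "star b = b" and f: "continuous_on (spectrum b) f"
  obtains y where "cfc_limit b f y"
proof -
  obtain Q where Q: "uniform_limit (spectrum b) (\<lambda>n. poly (Q n)) f sequentially"
    using uniform_polynomial_approximation[OF compact_spectrum spectrum_real[OF b] f] by blast
  have "Cauchy (\<lambda>n. poly_eval b (Q n))"
  proof (rule metric_CauchyI)
    fix e :: real assume "0 < e"
    then have "\<forall>\<^sub>F n in sequentially. \<forall>z\<in>spectrum b. dist (poly (Q n) z) (f z) < e / 3"
      using uniform_limitD[OF Q, of "e / 3"] by simp
    then obtain N
      where N: "\<And>n z. N \<le> n \<Longrightarrow> z \<in> spectrum b \<Longrightarrow> dist (poly (Q n) z) (f z) < e / 3"
      unfolding eventually_sequentially by blast
    have "dist (poly_eval b (Q m)) (poly_eval b (Q n)) < e" if mn: "N \<le> m" "N \<le> n" for m n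
    proof -
      have "norm (poly_eval b (Q m - Q n)) \<le> 2 * e / 3"
      proof (rule norm_poly_eval_le[OF b])
        fix z assume z: "z \<in> spectrum b"
        have "dist (poly (Q m) z) (poly (Q n) z) \<le> e / 3 + e / 3"
          using N[OF mn(1) z] N[OF mn(2) z] dist_triangle2[of "poly (Q m) z" "poly (Q n) z" "f z"]
          by linarith
        then show "cmod (poly (Q m - Q n) z) \<le> 2 * e / 3" by (simp add: dist_norm)
      qed (use \<open>0 < e\<close> in simp)
      with \<open>0 < e\<close> show ?thesis by (simp add: dist_norm poly_eval_diff)
    qed
    then show "\<exists>N. \<forall>m\<ge>N. \<forall>n\<ge>N. dist (poly_eval b (Q m)) (poly_eval b (Q n)) < e" by blast
  qed
  then obtain y where "(\<lambda>n. poly_eval b (Q n)) \<longlonglongrightarrow> y"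
    by (auto simp: Cauchy_convergent_iff convergent_def)
  with Q have "cfc_limit b f y" by (auto simp: cfc_limit_def)
  then show ?thesis by (rule that)
qed

section \<open>Existence and uniqueness of the functional calculus homomorphism\<close>

lemma cfc_hom_one: "cfc_hom b \<Phi> \<Longrightarrow> \<Phi> (\<lambda>z. 1) = \<one>"
  unfolding cfc_hom_def unity_one by (elim conjE)

lemma cfc_hom_id: "cfc_hom b \<Phi> \<Longrightarrow> \<Phi> (\<lambda>z. z) = b"
  unfolding cfc_hom_def by (elim conjE)

lemma cfc_hom_exists:
  fixes b :: 'a
  assumes b: "star b = b"
  shows "\<exists>\<Phi>. cfc_hom b \<Phi>"
proof -
  define \<Phi> where "\<Phi> f = (THE y. cfc_limit b f y)" for f
  have \<Phi>_eq: "\<Phi> f = y" if "cfc_limit b f y" "continuous_on (spectrum b) f" for f y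
    unfolding \<Phi>_def using that cfc_limit_unique[OF b] by blast
  have \<Phi>: "cfc_limit b f (\<Phi> f)" if "continuous_on (spectrum b) f" for f
    using cfc_limit_exists[OF b that] \<Phi>_eq that by metis
  have "cfc_hom b \<Phi>"
    unfolding cfc_hom_def
  proof (intro conjI allI impI)
    fix f g :: "complex \<Rightarrow> complex"
    assume fg: "continuous_on (spectrum b) f" "continuous_on (spectrum b) g"
    show "\<Phi> f = \<Phi> g" if "\<forall>z\<in>spectrum b. f z = g z"
      using that by (intro \<Phi>_eq cfc_limit_cong[OF \<Phi>[OF fg(2)]] fg) auto
    show "\<Phi> (\<lambda>z. f z + g z) = \<Phi> f + \<Phi> g"
      by (intro \<Phi>_eq cfc_limit_add \<Phi> continuous_intros fg)
    show "\<Phi> (\<lambda>z. f z * g z) = \<Phi> f * \<Phi> g"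
      by (intro \<Phi>_eq cfc_limit_mult \<Phi> continuous_intros fg)
  next
    fix f :: "complex \<Rightarrow> complex"
    assume f: "continuous_on (spectrum b) f"
    show "\<Phi> (\<lambda>z. c * f z) = c *\<^sub>C \<Phi> f" for c
      by (intro \<Phi>_eq cfc_limit_scaleC \<Phi> continuous_intros f)
    show "\<Phi> (\<lambda>z. cnj (f z)) = star (\<Phi> f)"
      by (intro \<Phi>_eq cfc_limit_star b \<Phi> continuous_intros f)
  next
    show "\<Phi> (\<lambda>z. 1) = unity"
    proof (rule \<Phi>_eq)
      have "poly [:1:] = (\<lambda>z::complex. 1)" by (simp add: fun_eq_iff)
      then show "cfc_limit b (\<lambda>z. 1) unity"
        using cfc_limit_poly[of b "[:1:]"] by (simp add: scaleC_one)
    qed (rule continuous_intros)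
    show "\<Phi> (\<lambda>z. z) = b"
    proof (rule \<Phi>_eq)
      have "poly [:0, 1:] = (\<lambda>z::complex. z)" by (simp add: fun_eq_iff)
      then show "cfc_limit b (\<lambda>z. z) b"
        using cfc_limit_poly[of b "[:0, 1:]"] by (simp add: scaleC_one)
    qed (rule continuous_intros)
  qed
  then show ?thesis by blast
qed

text \<open>Contractivity is automatic: \<open>g + \<i>\<surd>(1 - g\<^sup>2)\<close> is mapped to a unitary for real \<open>g\<close>.\<close>

lemma norm_cfc_hom_le:
  fixes b :: 'a
  assumes \<Phi>: "cfc_hom b \<Phi>" and f: "continuous_on (spectrum b) f"
    and "0 < M" and M: "\<And>z. z \<in> spectrum b \<Longrightarrow> cmod (f z) \<le> M"
  shows "norm (\<Phi> f) \<le> M"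
proof -
  let ?C = "continuous_on (spectrum b)"
  have cong: "\<Phi> f = \<Phi> g" if "?C f" "?C g" "\<And>z. z \<in> spectrum b \<Longrightarrow> f z = g z" for f g :: "complex \<Rightarrow> complex"
    using \<Phi> that unfolding cfc_hom_def by blast
  have add: "\<Phi> (\<lambda>z. f z + g z) = \<Phi> f + \<Phi> g" if "?C f" "?C g" for f g :: "complex \<Rightarrow> complex"
    using \<Phi> that unfolding cfc_hom_def by blast
  have mult: "\<Phi> (\<lambda>z. f z * g z) = \<Phi> f * \<Phi> g" if "?C f" "?C g" for f g :: "complex \<Rightarrow> complex"
    using \<Phi> that unfolding cfc_hom_def by blast
  have scale: "\<Phi> (\<lambda>z. c * f z) = c *\<^sub>C \<Phi> f" if "?C f" for c and f :: "complex \<Rightarrow> complex"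
    using \<Phi> that unfolding cfc_hom_def by blast
  have cnj: "\<Phi> (\<lambda>z. cnj (f z)) = star (\<Phi> f)" if "?C f" for f :: "complex \<Rightarrow> complex"
    using \<Phi> that unfolding cfc_hom_def by blast
  have unit: "\<Phi> (\<lambda>z. 1) = \<one>"
    by (rule cfc_hom_one[OF \<Phi>])
  \<comment> \<open>Passing to \<open>g\<close>, with values in [0, 1] on the spectrum, reduces a
    complex \<open>f\<close> to a real function: \<open>\<Phi> ?g\<close> is
    \<open>star (\<Phi> f) * \<Phi> f\<close> divided by M^2, and the C*-identity leads back to
    \<open>f\<close>.\<close>
  define g where "g z = (cmod (f z) / M)\<^sup>2" for z
  define h where "h z = sqrt (1 - (g z)\<^sup>2)" for z
  let ?g = "\<lambda>z. complex_of_real (g z)" and ?h = "\<lambda>z. complex_of_real (h z)"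
  have g: "?C ?g"
    unfolding g_def by (intro continuous_intros f) (use \<open>0 < M\<close> in auto)
  have h: "?C ?h"
    unfolding h_def g_def by (intro continuous_intros f) (use \<open>0 < M\<close> in auto)
  have "(norm (\<Phi> ?g))\<^sup>2 \<le> 1"
  proof (rule norm_le_of_sum_squares)
    show "star (\<Phi> ?g) = \<Phi> ?g" "star (\<Phi> ?h) = \<Phi> ?h"
      using cnj[OF g] cnj[OF h] by simp_all
    show "\<Phi> ?g * \<Phi> ?h = \<Phi> ?h * \<Phi> ?g"
      using mult[OF g h] mult[OF h g] by (simp add: mult.commute)
    have "\<Phi> (\<lambda>z. ?g z * ?g z + ?h z * ?h z) = \<Phi> (\<lambda>z. 1)"
    proof (rule cong)
      fix z assume "z \<in> spectrum b"
      then have "g z \<le> 1" "0 \<le> g z"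
        using M[of z] \<open>0 < M\<close> by (simp_all add: g_def power_le_one)
      then have "(g z)\<^sup>2 \<le> 1" by (simp add: power_le_one)
      then have "g z * g z + h z * h z = 1"
        by (simp add: h_def power2_eq_square)
      then show "?g z * ?g z + ?h z * ?h z = 1"
        by (metis of_real_1 of_real_add of_real_mult)
    qed (intro continuous_intros g h)+
    then show "\<Phi> ?g * \<Phi> ?g + \<Phi> ?h * \<Phi> ?h = complex_of_real 1 *\<^sub>C \<one>"
      using add[of "\<lambda>z. ?g z * ?g z" "\<lambda>z. ?h z * ?h z"] mult[OF g g] mult[OF h h] unit g h
      by (simp add: scaleC_one continuous_on_mult)
  qed simp
  then have "norm (\<Phi> ?g) \<le> 1" by (simp add: power_le_one_iff)
  moreover have "\<Phi> ?g = complex_of_real (1 / M\<^sup>2) *\<^sub>C (star (\<Phi> f) * \<Phi> f)"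
  proof -
    have "?C (\<lambda>z. cnj (f z) * f z)" by (intro continuous_intros f)
    then have "\<Phi> (\<lambda>z. complex_of_real (1 / M\<^sup>2) * (cnj (f z) * f z)) =
        complex_of_real (1 / M\<^sup>2) *\<^sub>C \<Phi> (\<lambda>z. cnj (f z) * f z)"
      by (rule scale)
    also have "\<Phi> (\<lambda>z. cnj (f z) * f z) = star (\<Phi> f) * \<Phi> f"
      unfolding cnj[OF f, symmetric] by (intro mult continuous_intros f)
    finally have "\<Phi> (\<lambda>z. complex_of_real (1 / M\<^sup>2) * (cnj (f z) * f z)) =
        complex_of_real (1 / M\<^sup>2) *\<^sub>C (star (\<Phi> f) * \<Phi> f)" .
    moreover have "complex_of_real (1 / M\<^sup>2) * (cnj (f z) * f z) = ?g z" for z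
      using complex_norm_square[of "f z"]
      by (simp add: g_def power_divide mult.commute)
    ultimately show ?thesis by simp
  qed
  ultimately have "(norm (\<Phi> f))\<^sup>2 \<le> M\<^sup>2"
    using \<open>0 < M\<close> by (simp add: norm_scaleC cstar_identity norm_divide norm_power)
  then show ?thesis
    by (rule power2_le_imp_le) (use \<open>0 < M\<close> in simp)
qed

lemma cfc_hom_poly:
  fixes b :: 'a
  assumes "cfc_hom b \<Phi>"
  shows "\<Phi> (poly q) = poly_eval b q"
proof (induct q)
  case 0
  have "\<Phi> (\<lambda>z. 0 * 1) = 0 *\<^sub>C \<Phi> (\<lambda>z. 1)"
    using assms continuous_on_const unfolding cfc_hom_def by blast
  moreover have "poly 0 = (\<lambda>z::complex. 0 * 1)"
    by (simp add: fun_eq_iff)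
  ultimately show ?case by simp
next
  case (pCons c q)
  have cont: "continuous_on (spectrum b) (\<lambda>z. c * 1)" "continuous_on (spectrum b) (\<lambda>z::complex. z)"
    "continuous_on (spectrum b) (poly q)"
    "continuous_on (spectrum b) (\<lambda>z. z * poly q z)"
    by (intro continuous_intros)+
  have "poly (pCons c q) = (\<lambda>z. c * 1 + z * poly q z)"
    by (simp add: fun_eq_iff)
  then have "\<Phi> (poly (pCons c q)) = \<Phi> (\<lambda>z. c * 1 + z * poly q z)"
    by simp
  also have "\<dots> = \<Phi> (\<lambda>z. c * 1) + \<Phi> (\<lambda>z. z * poly q z)"
    using assms cont unfolding cfc_hom_def by blast
  also have "\<Phi> (\<lambda>z. c * 1) = c *\<^sub>C \<Phi> (\<lambda>z. 1)"
    using assms continuous_on_const unfolding cfc_hom_def by blast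
  also have "\<Phi> (\<lambda>z. z * poly q z) = \<Phi> (\<lambda>z. z) * \<Phi> (poly q)"
    using assms cont unfolding cfc_hom_def by blast
  finally show ?case
    by (simp add: pCons cfc_hom_one[OF assms] cfc_hom_id[OF assms])
qed

text \<open>Any such \<open>\<Phi>\<close> agrees with \<open>poly_eval\<close> on polynomials and
  is contractive, so its value at \<open>f\<close> is the limit along a uniform approximation of
  \<open>f\<close>. Uniqueness follows, with continuity of \<open>\<Phi>\<close> not
  assumed.\<close>

lemma cfc_hom_cfc_limit:
  fixes b :: 'a
  assumes b: "star b = b" and \<Phi>: "cfc_hom b \<Phi>" and f: "continuous_on (spectrum b) f"
  shows "cfc_limit b f (\<Phi> f)"
proof -
  obtain Q where Q: "uniform_limit (spectrum b) (\<lambda>n. poly (Q n)) f sequentially"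
    using uniform_polynomial_approximation[OF compact_spectrum spectrum_real[OF b] f] by blast
  have diff: "poly_eval b q - \<Phi> f = \<Phi> (\<lambda>z. poly q z + (-1) * f z)" for q
  proof -
    have "\<Phi> (\<lambda>z. poly q z + (-1) * f z) = \<Phi> (poly q) + \<Phi> (\<lambda>z. (-1) * f z)"
      using \<Phi> f continuous_on_poly[OF continuous_on_id] continuous_on_mult_left[OF f]
      unfolding cfc_hom_def by blast
    also have "\<Phi> (\<lambda>z. (-1) * f z) = (-1) *\<^sub>C \<Phi> f"
      using \<Phi> f unfolding cfc_hom_def by blast
    finally show ?thesis by (simp add: cfc_hom_poly[OF \<Phi>] scaleC_one)
  qed
  have "(\<lambda>n. poly_eval b (Q n)) \<longlonglongrightarrow> \<Phi> f"
  proof (rule tendstoI)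
    fix e :: real assume e: "0 < e"
    then have "\<forall>\<^sub>F n in sequentially. \<forall>z\<in>spectrum b. dist (poly (Q n) z) (f z) < e / 2"
      using uniform_limitD[OF Q, of "e / 2"] by simp
    then show "\<forall>\<^sub>F n in sequentially. dist (poly_eval b (Q n)) (\<Phi> f) < e"
    proof eventually_elim
      case (elim n)
      have "norm (\<Phi> (\<lambda>z. poly (Q n) z + (-1) * f z)) \<le> e / 2"
        using elim e by (intro norm_cfc_hom_le[OF \<Phi>] continuous_intros f)
          (auto simp: dist_norm intro: less_imp_le)
      with e show ?case by (simp add: dist_norm diff)
    qed
  qed
  with Q show ?thesis by (auto simp: cfc_limit_def)
qed

text \<open>All homomorphisms share their values at continuous functions, so the definite
  description in \<open>cfc\<close> denotes there the value of any one of them, and its rules are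
  inherited.\<close>

lemma cfc_hom_cfc:
  fixes b :: 'a
  assumes b: "star b = b"
  shows "cfc_hom b (\<lambda>f. cfc f b)"
proof -
  obtain \<Phi> where \<Phi>: "cfc_hom b \<Phi>"
    using cfc_hom_exists[OF b] by blast
  have eq: "cfc f b = \<Phi> f" if f: "continuous_on (spectrum b) f" for f
    unfolding cfc_def
  proof (rule the_equality)
    show "\<exists>\<Psi>. cfc_hom b \<Psi> \<and> \<Psi> f = \<Phi> f" using \<Phi> by blast
    fix y assume "\<exists>\<Psi>. cfc_hom b \<Psi> \<and> \<Psi> f = y"
    then obtain \<Psi> where "cfc_hom b \<Psi>" "\<Psi> f = y" by blast
    then show "y = \<Phi> f"
      using cfc_limit_unique[OF b cfc_hom_cfc_limit[OF b _ f] cfc_hom_cfc_limit[OF b \<Phi> f] f]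
      by blast
  qed
  show ?thesis
    unfolding cfc_hom_def
  proof (intro conjI allI impI)
    fix f g :: "complex \<Rightarrow> complex"
    assume fg: "continuous_on (spectrum b) f" "continuous_on (spectrum b) g"
    show "cfc f b = cfc g b" if "\<forall>z\<in>spectrum b. f z = g z"
      unfolding eq[OF fg(1)] eq[OF fg(2)] using \<Phi> fg that unfolding cfc_hom_def by blast
    show "cfc (\<lambda>z. f z + g z) b = cfc f b + cfc g b"
      unfolding eq[OF fg(1)] eq[OF fg(2)] eq[OF continuous_on_add[OF fg]]
      using \<Phi> fg unfolding cfc_hom_def by blast
    show "cfc (\<lambda>z. f z * g z) b = cfc f b * cfc g b"
      unfolding eq[OF fg(1)] eq[OF fg(2)] eq[OF continuous_on_mult[OF fg]]
      using \<Phi> fg unfolding cfc_hom_def by blast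
  next
    fix f :: "complex \<Rightarrow> complex"
    assume f: "continuous_on (spectrum b) f"
    show "cfc (\<lambda>z. c * f z) b = c *\<^sub>C cfc f b" for c
      unfolding eq[OF f] eq[OF continuous_on_mult_left[OF f]]
      using \<Phi> f unfolding cfc_hom_def by blast
    show "cfc (\<lambda>z. cnj (f z)) b = star (cfc f b)"
      unfolding eq[OF f] eq[OF continuous_on_cnj[OF f]]
      using \<Phi> f unfolding cfc_hom_def by blast
  next
    show "cfc (\<lambda>z. 1) b = unity" "cfc (\<lambda>z. z) b = b"
      unfolding eq[OF continuous_on_const] eq[OF continuous_on_id]
      by (simp_all add: cfc_hom_one[OF \<Phi>] cfc_hom_id[OF \<Phi>])
  qed
qed

section \<open>Rules for the functional calculus\<close>

lemma
  fixes b :: 'a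
  assumes b: "star b = b" and f: "continuous_on (spectrum b) f"
  shows cfc_scaleC: "cfc (\<lambda>z. c * f z) b = c *\<^sub>C cfc f b"
    and cfc_cnj: "cfc (\<lambda>z. cnj (f z)) b = star (cfc f b)"
    and cfc_cong: "(\<And>z. z \<in> spectrum b \<Longrightarrow> f z = g z) \<Longrightarrow> cfc f b = cfc g b"
    and cfc_add: "continuous_on (spectrum b) g \<Longrightarrow> cfc (\<lambda>z. f z + g z) b = cfc f b + cfc g b"
    and cfc_mult: "continuous_on (spectrum b) g \<Longrightarrow> cfc (\<lambda>z. f z * g z) b = cfc f b * cfc g b"
    and norm_cfc_le: "0 < M \<Longrightarrow> (\<And>z. z \<in> spectrum b \<Longrightarrow> cmod (f z) \<le> M) \<Longrightarrow> norm (cfc f b) \<le> M"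
proof -
  note hom = cfc_hom_cfc[OF b]
  show "cfc f b = cfc g b" if "\<And>z. z \<in> spectrum b \<Longrightarrow> f z = g z"
  proof -
    have "continuous_on (spectrum b) g"
      using f that by (simp cong: continuous_on_cong)
    then show ?thesis using hom f that unfolding cfc_hom_def by blast
  qed
  show "cfc (\<lambda>z. c * f z) b = c *\<^sub>C cfc f b" "cfc (\<lambda>z. cnj (f z)) b = star (cfc f b)"
    using hom f unfolding cfc_hom_def by blast+
  show "cfc (\<lambda>z. f z + g z) b = cfc f b + cfc g b"
    "cfc (\<lambda>z. f z * g z) b = cfc f b * cfc g b" if "continuous_on (spectrum b) g"
    using hom f that unfolding cfc_hom_def by blast+
  show "norm (cfc f b) \<le> M" if "0 < M" "\<And>z. z \<in> spectrum b \<Longrightarrow> cmod (f z) \<le> M"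
    using norm_cfc_hom_le[OF hom f] that by blast
qed

lemma
  fixes b :: 'a
  assumes "star b = b"
  shows cfc_one: "cfc (\<lambda>z. 1) b = \<one>"
    and cfc_id: "cfc (\<lambda>z. z) b = b"
  using cfc_hom_one[OF cfc_hom_cfc[OF assms]] cfc_hom_id[OF cfc_hom_cfc[OF assms]] by auto

text \<open>If \<open>f(b) = 0\<close>, then \<open>z \<mapsto> (z - w)\<^sup>* / (|z - w|\<^sup>2 + |f|\<^sup>2)\<close> inverts \<open>b - w\<close>.\<close>

lemma cfc_nonzero:
  fixes b :: 'a
  assumes b: "star b = b" and f: "continuous_on (spectrum b) f"
    and w: "w \<in> spectrum b" "f w \<noteq> 0"
  shows "cfc f b \<noteq> 0"
proof
  assume zero: "cfc f b = 0"
  define h where "h z = complex_of_real ((cmod (w - z))\<^sup>2 + (cmod (f z))\<^sup>2)" for z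
  \<comment> \<open>The first square vanishes only at z = w, and there the second does not.\<close>
  have "(cmod (w - z))\<^sup>2 + (cmod (f z))\<^sup>2 \<noteq> 0" for z
    using w(2) by (cases "z = w") (auto simp: add_nonneg_eq_0_iff)
  then have h: "h z \<noteq> 0" for z
    unfolding h_def by (metis of_real_eq_0_iff)
  have h_eq: "h z = (w - z) * cnj (w - z) + f z * cnj (f z)" for z
    unfolding h_def complex_norm_square of_real_add by simp
  have cont_h: "continuous_on (spectrum b) h"
    unfolding h_def by (intro continuous_intros f)
  let ?k = "\<lambda>z. w - z" and ?m = "\<lambda>z. cnj (w - z) / h z" and ?r = "\<lambda>z. cnj (f z) / h z"
  have cont: "continuous_on (spectrum b) ?k" "continuous_on (spectrum b) ?m"
    "continuous_on (spectrum b) ?r"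
    by (intro continuous_intros f cont_h ballI h)+
  have "cfc ?k b = cfc (\<lambda>z. w * 1 + (-1) * z) b"
    by (intro cfc_cong b cont) simp
  also have "\<dots> = w *\<^sub>C \<one> - b"
  proof -
    have "cfc (\<lambda>z. w * 1) b = w *\<^sub>C cfc (\<lambda>z. 1) b" "cfc (\<lambda>z. (-1) * z) b = (-1) *\<^sub>C cfc (\<lambda>z. z) b"
      by (intro cfc_scaleC b continuous_intros)+
    moreover have "cfc (\<lambda>z. w * 1 + (-1) * z) b = cfc (\<lambda>z. w * 1) b + cfc (\<lambda>z. (-1) * z) b"
      by (intro cfc_add b continuous_intros)
    ultimately show ?thesis
      by (simp only: cfc_one[OF b] cfc_id[OF b]) (simp add: scaleC_one)
  qed
  finally have k: "cfc ?k b = w *\<^sub>C \<one> - b" .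
  have "cfc (\<lambda>z. ?k z * ?m z) b + cfc f b * cfc ?r b = \<one>"
  proof -
    have "\<one> = cfc (\<lambda>z. ?k z * ?m z + f z * ?r z) b"
    proof -
      have "?k z * ?m z + f z * ?r z = h z / h z" for z
        unfolding h_eq by (simp only: times_divide_eq_right add_divide_distrib)
      then show ?thesis using h by (simp add: cfc_one[OF b])
    qed
    also have "\<dots> = cfc (\<lambda>z. ?k z * ?m z) b + cfc (\<lambda>z. f z * ?r z) b"
      by (intro cfc_add b continuous_on_mult cont f)
    also have "cfc (\<lambda>z. f z * ?r z) b = cfc f b * cfc ?r b"
      by (rule cfc_mult[OF b f cont(3)])
    finally show ?thesis by (rule sym)
  qed
  then have "cfc ?k b * cfc ?m b = \<one>"
    unfolding cfc_mult[OF b cont(1,2)] zero by simp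
  moreover have "cfc ?m b * cfc ?k b = cfc ?k b * cfc ?m b"
    using cfc_mult[OF b cont(1,2)] cfc_mult[OF b cont(2,1)] by (simp add: mult.commute)
  ultimately have "is_inverse (w *\<^sub>C \<one> - b) (cfc ?m b)"
    by (simp add: is_inverse_def k)
  with w(1) show False using not_in_spectrum_iff by blast
qed

end

section \<open>Uniqueness of the C*-norm\<close>

lemma smooth_on_openI:
  assumes "g \<in> S"
    and deriv: "\<And>g. g \<in> S \<Longrightarrow> \<exists>h\<in>S. \<forall>x\<in>U. (g has_real_derivative h x) (at x)"
  shows "smooth_on_open U (\<lambda>x. complex_of_real (g x))"
proof -
  \<comment> \<open>The family \<open>S\<close> is stable under differentiation; choosing for each
    member a derivative inside \<open>S\<close> allows iteration without closed formulas for higher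
    derivatives.\<close>
  obtain d where d: "\<And>g. g \<in> S \<Longrightarrow> d g \<in> S"
    "\<And>g x. g \<in> S \<Longrightarrow> x \<in> U \<Longrightarrow> (g has_real_derivative d g x) (at x)"
    using deriv by metis
  let ?D = "\<lambda>n. (d ^^ n) g"
  have S: "?D n \<in> S" for n
    by (induct n) (simp_all add: assms(1) d(1))
  show ?thesis
    unfolding smooth_on_open_def
  proof (intro exI[of _ "\<lambda>n x. complex_of_real (?D n x)"] conjI ballI allI)
    fix n x assume "x \<in> U"
    then have "(?D n has_vector_derivative ?D (Suc n) x) (at x)"
      using d(2)[OF S] by (simp add: has_real_derivative_iff_has_vector_derivative)
    then show "((\<lambda>x. complex_of_real (?D n x)) has_vector_derivative
        complex_of_real (?D (Suc n) x)) (at x)"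
      by (rule bounded_linear.has_vector_derivative[OF bounded_linear_of_real])
  qed simp
qed

lemma smooth_on_open_continuous:
  assumes "smooth_on_open U f"
  shows "continuous_on U f"
proof -
  obtain D where D: "\<forall>x\<in>U. D 0 x = f x"
    "\<forall>n. \<forall>x\<in>U. (D n has_vector_derivative D (Suc n) x) (at x)"
    using assms unfolding smooth_on_open_def by blast
  have "continuous_on U (D 0)"
    using D(2) by (meson continuous_at_imp_continuous_on has_vector_derivative_continuous)
  then show ?thesis
    using D(1) by (simp cong: continuous_on_cong)
qed

lemma has_real_derivative_inverse_power:
  fixes f :: "real \<Rightarrow> real"
  assumes "(f has_real_derivative f') (at x)" "f x \<noteq> 0"
  shows "((\<lambda>t. inverse (f t ^ n)) has_real_derivative - real n * f' * inverse (f x ^ Suc n)) (at x)"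
proof (cases n)
  case (Suc k)
  have "((\<lambda>t. inverse (f t ^ Suc k)) has_real_derivative
      - (inverse (f x ^ Suc k) * (real (Suc k) * (f' * f x ^ k)) * inverse (f x ^ Suc k))) (at x)"
    using assms(2) DERIV_power_Suc[OF assms(1), of k]
    by (intro DERIV_inverse') (simp_all add: algebra_simps)
  moreover have "- (inverse (f x ^ Suc k) * (real (Suc k) * (f' * f x ^ k)) * inverse (f x ^ Suc k))
      = - real (Suc k) * f' * inverse (f x ^ Suc (Suc k))"
    using assms(2) by (simp add: field_simps)
  ultimately show ?thesis by (simp only: Suc)
qed simp

text \<open>The functions P(t) (1 - t^2)^(1/2 - n) with a polynomial P form a family stable under
  differentiation.\<close>

lemma smooth_sqrt_one_minus_square:
  "smooth_on_open {-1<..<1} (\<lambda>t. complex_of_real (sqrt (1 - t\<^sup>2)))"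
proof (rule smooth_on_openI)
  let ?g = "\<lambda>(P :: real poly) n t. poly P t * sqrt (1 - t\<^sup>2) / (1 - t\<^sup>2) ^ n"
  show "(\<lambda>t. sqrt (1 - t\<^sup>2)) \<in> {?g P n | P n. True}"
    by (intro CollectI exI[of _ 1] exI[of _ 0]) simp
  fix g assume "g \<in> {?g P n | P n. True}"
  then obtain P n where g: "g = ?g P n" by blast
  \<comment> \<open>The coefficient 2 n - 1 is 1/2 - n times the factor -2 from the derivative of 1
    - t^2.\<close>
  let ?Q = "pderiv P * [:1, 0, -1:] + smult (2 * real n - 1) ([:0, 1:] * P)"
  have "(g has_real_derivative ?g ?Q (Suc n) x) (at x)" if "x \<in> {-1<..<1}" for x
  proof -
    let ?w = "1 - x\<^sup>2"
    have w: "0 < ?w" using that by (simp add: abs_square_less_1 abs_less_iff)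
    have s: "((\<lambda>t. sqrt (1 - t\<^sup>2)) has_real_derivative - x / sqrt ?w) (at x)"
      using w by (auto intro!: derivative_eq_intros simp: field_simps)
    have i: "((\<lambda>t. inverse ((1 - t\<^sup>2) ^ n)) has_real_derivative
        2 * real n * x * inverse (?w ^ Suc n)) (at x)"
    proof -
      have "((\<lambda>t. 1 - t\<^sup>2) has_real_derivative - 2 * x) (at x)"
        by (auto intro!: derivative_eq_intros)
      from has_real_derivative_inverse_power[OF this, of n] w show ?thesis
        by (simp add: mult_ac)
    qed
    have "((\<lambda>t. poly P t * (sqrt (1 - t\<^sup>2) * inverse ((1 - t\<^sup>2) ^ n))) has_real_derivative
        poly (pderiv P) x * (sqrt ?w * inverse (?w ^ n)) +
        (- x / sqrt ?w * inverse (?w ^ n) + 2 * real n * x * inverse (?w ^ Suc n) * sqrt ?w)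
          * poly P x) (at x)"
      by (intro DERIV_mult poly_DERIV s i)
    moreover have "poly (pderiv P) x * (sqrt ?w * inverse (?w ^ n)) +
        (- x / sqrt ?w * inverse (?w ^ n) + 2 * real n * x * inverse (?w ^ Suc n) * sqrt ?w)
          * poly P x = ?g ?Q (Suc n) x"
    proof -
      have alg: "P' * (s * v) + (- x * (s / w) * v + 2 * m * x * (v / w) * s) * P0
          = (P' * w + (2 * m - 1) * (x * P0)) * s * (v / w)" if "w \<noteq> 0" for P' P0 s v w m :: real
        using that by (simp add: field_simps)
      have "- x / sqrt ?w = - x * (sqrt ?w / ?w)"
        using sqrt_divide_self_eq[of ?w] w by (simp add: divide_inverse)
      moreover have "inverse (?w ^ Suc n) = inverse (?w ^ n) / ?w"
        by (simp add: divide_inverse)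
      moreover have "poly ?Q x = poly (pderiv P) x * ?w + (2 * real n - 1) * (x * poly P x)"
        by (simp add: power2_eq_square algebra_simps)
      ultimately show ?thesis
        using alg[of ?w "poly (pderiv P) x" "sqrt ?w" "inverse (?w ^ n)" "real n" "poly P x"] w
        by (simp only: divide_inverse[of _ "?w ^ Suc n"])
    qed
    ultimately show ?thesis by (simp add: g divide_inverse mult.assoc)
  qed
  then have "\<forall>x\<in>{-1<..<1}. (g has_real_derivative ?g ?Q (Suc n) x) (at x)"
    by (intro ballI)
  moreover have "?g ?Q (Suc n) \<in> {?g P n | P n. True}"
    by (intro CollectI exI conjI TrueI) (rule refl)
  ultimately show "\<exists>h\<in>{?g P n | P n. True}. \<forall>x\<in>{-1<..<1}. (g has_real_derivative h x) (at x)"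
    by (rule bexI)
qed

text \<open>With s = t - r this is exponential decay against powers of 1/s. It settles the
  difference quotients at the point \<open>r\<close> where \<open>flat\<close> is glued to
  0.\<close>

lemma exp_minus_inverse_over_power_tendsto_0:
  "((\<lambda>t. exp (- (1 / (t - r))) / (t - r) ^ k) \<longlongrightarrow> (0::real)) (at_right r)"
proof -
  have "((\<lambda>s. inverse s ^ k / exp (inverse s)) \<longlongrightarrow> (0::real)) (at_right 0)"
    by (rule filterlim_compose[OF tendsto_power_div_exp_0 filterlim_inverse_at_top_right])
  moreover have "inverse s ^ k / exp (inverse s) = exp (- (1 / s)) / s ^ k" for s :: real
    by (simp add: exp_minus field_simps)
  ultimately show ?thesis
    by (subst filterlim_at_right_to_0) simp
qed

text \<open>These are the functions f_n of the proof idea: the standard smooth cutoff that is flat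
  at \<open>r\<close>, divided by t^n.\<close>

definition flat :: "real \<Rightarrow> nat \<Rightarrow> real \<Rightarrow> real"
  where "flat r n t = (if r < t then exp (- (1 / (t - r))) / t ^ n else 0)"

text \<open>The functions e^(-1/(t - r)) P(t) / ((t - r)^m t^n), extended by 0 to t \<le> r, form a
  family stable under differentiation; r > 0 keeps t away from 0 where they do not vanish
  identically.\<close>

lemma smooth_flat:
  assumes "0 < r"
  shows "smooth_on_open UNIV (\<lambda>t. complex_of_real (flat r n t))"
proof (rule smooth_on_openI)
  let ?e = "\<lambda>t. exp (- (1 / (t - r)))"
  let ?g = "\<lambda>(P :: real poly) m n t.
    if r < t then ?e t * (poly P t * (inverse ((t - r) ^ m) * inverse (t ^ n))) else 0"
  let ?S = "{?g P m n | P m n. True}"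
  show "flat r n \<in> ?S"
    by (intro CollectI exI[of _ 1] exI[of _ 0] exI[of _ n]) (auto simp: flat_def fun_eq_iff divide_inverse)
  fix g assume "g \<in> ?S"
  then obtain P m n where g: "g = ?g P m n" by blast
  let ?X = "[:0, 1:]" and ?Y = "[:- r, 1:]"
  \<comment> \<open>Numerator of the derivative over (t - r)^(m + 2) t^(n + 1); the exponential
    contributes 1/(t - r)^2, hence the step of 2 in the exponent.\<close>
  let ?Q = "?X * P - smult (real m) (?Y * ?X * P) - smult (real n) (?Y * ?Y * P)
    + ?Y * ?Y * ?X * pderiv P"
  have "(g has_real_derivative ?g ?Q (m + 2) (n + 1) x) (at x)" for x
  proof (cases x r rule: linorder_cases)
    case less
    have "((\<lambda>t. 0) has_real_derivative 0) (at x)" by simp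
    then have "(g has_real_derivative 0) (at x)"
      by (rule has_field_derivative_transform_within_open[of _ _ _ "{..<r}"])
        (use less in \<open>auto simp: g\<close>)
    then show ?thesis using less by simp
  next
    case equal
    \<comment> \<open>From the left the quotient is 0; from the right, division by t - r only raises
      an exponent to m + 1, and the exponential still wins.\<close>
    have "((\<lambda>t. (g t - g x) / (t - x)) \<longlongrightarrow> 0) (at x)"
    proof (rule filterlim_split_at)
      show "((\<lambda>t. (g t - g x) / (t - x)) \<longlongrightarrow> 0) (at_left x)"
        by (rule tendsto_eventually) (auto simp: g equal eventually_at_left_field intro: exI[of _ "r - 1"])
      have "((\<lambda>t. (?e t / (t - r) ^ Suc m) * (poly P t * inverse (t ^ n))) \<longlongrightarrow>
          0 * (poly P r * inverse (r ^ n))) (at_right r)"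
        using assms
        by (intro tendsto_mult exp_minus_inverse_over_power_tendsto_0 tendsto_intros tendsto_inverse) auto
      moreover have "\<forall>\<^sub>F t in at_right r.
          (?e t / (t - r) ^ Suc m) * (poly P t * inverse (t ^ n)) = (g t - g r) / (t - r)"
        unfolding eventually_at_right_field
        by (intro exI[of _ "r + 1"]) (auto simp: g divide_inverse)
      ultimately have "((\<lambda>t. (g t - g r) / (t - r)) \<longlongrightarrow>
          0 * (poly P r * inverse (r ^ n))) (at_right r)"
        by (rule Lim_transform_eventually)
      then show "((\<lambda>t. (g t - g x) / (t - x)) \<longlongrightarrow> 0) (at_right x)"
        by (simp only: equal mult_zero_left)
    qed
    then show ?thesis using equal by (simp add: has_field_derivative_iff)
  next
    case greater
    let ?y = "x - r"
    have pos: "0 < ?y" "0 < x" using greater assms by auto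
    have e: "(?e has_real_derivative ?e x * (1 / ?y\<^sup>2)) (at x)"
      using pos by (auto intro!: derivative_eq_intros simp: field_simps power2_eq_square)
    have i1: "((\<lambda>t. inverse ((t - r) ^ m)) has_real_derivative
        - real m * inverse (?y ^ Suc m)) (at x)"
    proof -
      have "((\<lambda>t. t - r) has_real_derivative 1) (at x)"
        by (auto intro!: derivative_eq_intros)
      from has_real_derivative_inverse_power[OF this, of m] pos show ?thesis by simp
    qed
    have i2: "((\<lambda>t. inverse (t ^ n)) has_real_derivative - real n * inverse (x ^ Suc n)) (at x)"
      using has_real_derivative_inverse_power[OF DERIV_ident, of x n] pos by simp
    let ?a = "inverse (?y ^ m)" and ?b = "inverse (x ^ n)"
    have "((\<lambda>t. ?e t * (poly P t * (inverse ((t - r) ^ m) * inverse (t ^ n)))) has_real_derivative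
      ?e x * (1 / ?y\<^sup>2) * (poly P x * (?a * ?b)) +
      (poly (pderiv P) x * (?a * ?b) +
        (- real m * inverse (?y ^ Suc m) * ?b + - real n * inverse (x ^ Suc n) * ?a) * poly P x)
      * ?e x) (at x)"
      by (intro DERIV_mult poly_DERIV e i1 i2)
    also have "?e x * (1 / ?y\<^sup>2) * (poly P x * (?a * ?b)) +
      (poly (pderiv P) x * (?a * ?b) +
        (- real m * inverse (?y ^ Suc m) * ?b + - real n * inverse (x ^ Suc n) * ?a) * poly P x)
      * ?e x = ?g ?Q (m + 2) (n + 1) x"
    proof -
      have alg: "E * (1 / y\<^sup>2) * (P0 * (a * c)) +
          (P' * (a * c) + (- k * (a / y) * c + - l * (c / x) * a) * P0) * E
          = E * ((x * P0 - k * (y * x * P0) - l * (y * y * P0) + y * y * x * P')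
            * ((a / y\<^sup>2) * (c / x)))" if "y \<noteq> 0" for E y P0 P' a c k l
        using that pos by (simp add: field_simps power2_eq_square)
      have "inverse (?y ^ Suc m) = ?a / ?y" "inverse (x ^ Suc n) = ?b / x"
        "inverse (?y ^ (m + 2)) = ?a / ?y\<^sup>2" "inverse (x ^ (n + 1)) = ?b / x"
        by (simp_all add: divide_inverse power2_eq_square)
      moreover have "poly ?Q x = x * poly P x - real m * (?y * x * poly P x)
          - real n * (?y * ?y * poly P x) + ?y * ?y * x * poly (pderiv P) x"
        by (simp add: algebra_simps)
      ultimately show ?thesis
        using alg[of ?y "?e x" "poly P x" ?a ?b "poly (pderiv P) x" "real m" "real n"] pos greater
        by (simp only: if_True)
    qed
    finally show ?thesis
      by (rule has_field_derivative_transform_within_open[of _ _ _ "{r<..}"])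
        (use greater in \<open>auto simp: g\<close>)
  qed
  then have "\<forall>x\<in>UNIV. (g has_real_derivative ?g ?Q (m + 2) (n + 1) x) (at x)"
    by (intro ballI)
  moreover have "?g ?Q (m + 2) (n + 1) \<in> ?S"
    by (intro CollectI exI conjI TrueI) (rule refl)
  ultimately show "\<exists>h\<in>?S. \<forall>x\<in>UNIV. (g has_real_derivative h x) (at x)"
    by (rule bexI)
qed

lemma flat_eq_mult: "0 < r \<Longrightarrow> flat r n t = t * flat r (Suc n) t"
  by (simp add: flat_def)

lemma flat_bounds:
  assumes "0 < r"
  shows "0 \<le> flat r n t" "flat r n t \<le> (1 / r) ^ n"
proof -
  have "exp (- (1 / (t - r))) / t ^ n \<le> 1 / r ^ n" if "r < t"
    using that assms by (intro frac_le power_mono) auto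
  then show "flat r n t \<le> (1 / r) ^ n"
    using assms by (simp add: flat_def power_divide)
  show "0 \<le> flat r n t"
    using assms by (simp add: flat_def)
qed

text \<open>Here \<open>D\<close> stands for \<open>B\<close> with the unit adjoined and
  \<open>I\<close> for the copy of \<open>B\<close> in it. As \<open>p\<close> is controlled only on
  \<open>I\<close>, elements of \<open>D\<close> enter the estimates as left multipliers of
  \<open>I\<close>.\<close>

locale smooth_cfc_ideal = unital_cstar_algebra +
  fixes I D :: "'a set" and p :: "'a \<Rightarrow> real"
  assumes star_subalgebra: "star_subalgebra I"
    and subset: "I \<subseteq> D"
    and ideal: "d \<in> D \<Longrightarrow> x \<in> I \<Longrightarrow> d * x \<in> I"
    and smooth_closed: "smooth_cfc_closed_unital D"
    and cstar_norm: "cstar_norm_on I p"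
begin

section \<open>Comparison of \<open>p\<close> with the norm\<close>

lemma I_closed:
  "x \<in> I \<Longrightarrow> y \<in> I \<Longrightarrow> x + y \<in> I" "x \<in> I \<Longrightarrow> c *\<^sub>C x \<in> I" "x \<in> I \<Longrightarrow> y \<in> I \<Longrightarrow> x * y \<in> I"
  "x \<in> I \<Longrightarrow> star x \<in> I"
  using star_subalgebra by (auto simp: star_subalgebra_def complex_subalgebra_def)

lemma p_norm:
  assumes "x \<in> I"
  shows "0 \<le> p x" "p x = 0 \<longleftrightarrow> x = 0" "p (c *\<^sub>C x) = cmod c * p x" "p (star x * x) = (p x)\<^sup>2"
    and "y \<in> I \<Longrightarrow> p (x + y) \<le> p x + p y" "y \<in> I \<Longrightarrow> p (x * y) \<le> p x * p y"
  using cstar_norm assms by (auto simp: cstar_norm_on_def)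

text \<open>In the C*-identity for \<open>w * x\<close> the factor \<open>star w * w\<close>
  cancels. Only products with \<open>x\<close> occur, because \<open>w\<close> itself may lie
  outside \<open>I\<close>.\<close>

lemma p_isometry:
  assumes "star w * w = \<one>" "x \<in> I" "w * x \<in> I"
  shows "p (w * x) = p x"
proof -
  have "star (w * x) * (w * x) = star x * (star w * w) * x"
    by (simp add: star_mult mult.assoc)
  then have "star (w * x) * (w * x) = star x * x"
    by (simp add: assms(1))
  then have "(p (w * x))\<^sup>2 = (p x)\<^sup>2"
    using p_norm(4)[OF assms(2)] p_norm(4)[OF assms(3)] by simp
  then show ?thesis
    using p_norm(1)[OF assms(2)] p_norm(1)[OF assms(3)] by simp
qed

text \<open>The element \<open>b\<close> is the average of the unitaries b \<plusminus> i c. As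
  these may lie outside \<open>I\<close>, the average is multiplied by \<open>b\<close>: 2 b^2 is a
  sum of two elements on which \<open>p\<close> takes the value \<open>p b\<close>, so p(b)^2 \<le>
  p(b).\<close>

lemma p_le_one:
  assumes b: "b \<in> I" "star b = b" and c: "c \<in> D" "star c = c"
    and comm: "b * c = c * b" and sum: "b * b + c * c = \<one>"
  shows "p b \<le> 1"
proof -
  let ?u = "b + \<i> *\<^sub>C c" and ?v = "b + (- \<i>) *\<^sub>C c"
  have mem: "?u * x \<in> I" "?v * x \<in> I" if "x \<in> I" for x
    using that b(1) ideal[OF c(1) that]
    by (simp_all only: distrib_right mult_scaleC_left I_closed)
  have "star ?u * ?u = b * b + c * c" "star ?v * ?v = b * b + c * c"
    using comm
    by (simp_all add: star_add star_diff star_scaleC b c algebra_simps mult_scaleC_left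
        mult_scaleC_right scaleC_scaleC scaleC_one)
  then have iso: "p (?u * b) = p b" "p (?v * b) = p b"
    using p_isometry[of ?u b] p_isometry[of ?v b] mem[OF b(1)] b(1) sum by simp_all
  have "?u * b + ?v * b = 2 *\<^sub>C (b * b)"
    using scaleC_add_left[of 1 1 "b * b"]
    by (simp add: distrib_right left_diff_distrib mult_scaleC_left scaleC_one)
  then have "2 * p (b * b) \<le> p b + p b"
    using p_norm(5)[OF mem[OF b(1)]] iso p_norm(3)[OF I_closed(3)[OF b(1) b(1)], of 2] by simp
  then have "p b * p b \<le> 1 * p b"
    using p_norm(4)[OF b(1)] b(2) by (simp add: power2_eq_square)
  then show ?thesis
    using p_norm(1)[OF b(1)] by (cases "p b = 0") auto
qed

lemma continuous_on_spectrum: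
  assumes "smooth_on_open U f" "spectrum b \<subseteq> complex_of_real ` U"
  shows "continuous_on (spectrum b) (\<lambda>z. f (Re z))"
  using assms(2)
  by (intro continuous_on_compose2[OF smooth_on_open_continuous[OF assms(1)]] continuous_intros) auto

lemma cfc_in_D:
  assumes "b \<in> D" "star b = b" "open U" "spectrum b \<subseteq> complex_of_real ` U" "smooth_on_open U f"
  shows "cfc (\<lambda>z. f (Re z)) b \<in> D"
  using smooth_closed assms unfolding smooth_cfc_closed_unital_def by blast

text \<open>The norm bound puts the spectrum into the open interval where \<surd>(1 - t^2) is
  smooth, so its value at \<open>b\<close> can serve as \<open>c\<close> in
  \<open>p_le_one\<close>.\<close>

lemma p_le_one_of_norm_less_one:
  assumes b: "b \<in> I" "star b = b" and "norm b < 1"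
  shows "p b \<le> 1"
proof -
  have real: "z = complex_of_real (Re z)" "Re z \<in> {-1<..<1}" if "z \<in> spectrum b" for z
    using spectrum_real[OF b(2) that] spectrum_bounded[OF that] abs_Re_le_cmod[of z] \<open>norm b < 1\<close>
    by auto
  have sp: "spectrum b \<subseteq> complex_of_real ` {-1<..<1}"
  proof
    fix z assume "z \<in> spectrum b"
    with real[of z] show "z \<in> complex_of_real ` {-1<..<1}" by (intro image_eqI[of z _ "Re z"])
  qed
  let ?s = "\<lambda>z. complex_of_real (sqrt (1 - (Re z)\<^sup>2))"
  have s: "continuous_on (spectrum b) ?s"
    by (rule continuous_on_spectrum[OF smooth_sqrt_one_minus_square sp])
  have comm: "b * cfc ?s b = cfc ?s b * b"
    using cfc_mult[OF b(2) s continuous_on_id] cfc_mult[OF b(2) continuous_on_id s]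
    by (simp add: cfc_id[OF b(2)] mult.commute)
  have "b * b + cfc ?s b * cfc ?s b = cfc (\<lambda>z. z * z) b + cfc (\<lambda>z. ?s z * ?s z) b"
    using cfc_mult[OF b(2) s s] cfc_mult[OF b(2) continuous_on_id continuous_on_id]
    by (simp only: cfc_id[OF b(2)])
  also have "\<dots> = cfc (\<lambda>z. z * z + ?s z * ?s z) b"
    by (intro cfc_add[symmetric] b continuous_intros s)
  also have "\<dots> = cfc (\<lambda>z. 1) b"
  proof (intro cfc_cong b continuous_intros s)
    fix z assume z: "z \<in> spectrum b"
    then have "(Re z)\<^sup>2 \<le> 1"
      using real(2)[OF z] by (simp add: abs_square_le_1 abs_le_iff)
    then have "complex_of_real ((Re z)\<^sup>2 + (sqrt (1 - (Re z)\<^sup>2))\<^sup>2) = 1" by simp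
    then show "z * z + ?s z * ?s z = 1"
      by (subst (1 2) real(1)[OF z]) (simp only: of_real_add of_real_mult power2_eq_square)
  qed
  also have "\<dots> = \<one>" by (rule cfc_one[OF b(2)])
  finally have sum: "b * b + cfc ?s b * cfc ?s b = \<one>" .
  have "cfc ?s b \<in> D"
    by (rule cfc_in_D[OF _ b(2) _ sp smooth_sqrt_one_minus_square]) (use b(1) subset in auto)
  moreover have "star (cfc ?s b) = cfc ?s b"
    using cfc_cnj[OF b(2) s] by simp
  ultimately show ?thesis
    using p_le_one[OF b _ _ comm sum] by blast
qed

lemma p_le_norm:
  assumes b: "b \<in> I" "star b = b"
  shows "p b \<le> norm b"
proof (rule field_le_epsilon)
  fix e :: real assume "0 < e"
  \<comment> \<open>Exceeding \<open>norm b\<close> by \<open>e\<close> makes the rescaled element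
    strictly contractive and avoids division by 0.\<close>
  define N where "N = norm b + e"
  have N: "0 < N" "norm b < N" using \<open>0 < e\<close> by (simp_all add: N_def add_nonneg_pos)
  have "p (complex_of_real (1 / N) *\<^sub>C b) \<le> 1"
    using N by (intro p_le_one_of_norm_less_one I_closed b)
      (simp_all add: star_scaleC b norm_scaleC norm_divide)
  then have "p b \<le> N"
    using N p_norm(3)[OF b(1), of "complex_of_real (1 / N)"] by (simp add: norm_divide)
  then show "p b \<le> norm b + e" by (simp add: N_def)
qed

lemma norm_le_p_of_norm_in_spectrum:
  assumes b: "b \<in> I" "star b = b" and sp: "complex_of_real (norm b) \<in> spectrum b"
  shows "norm b \<le> p b"
proof (rule ccontr)
  assume "\<not> ?thesis"
  then obtain r where r: "p b < r" "r < norm b"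
    using dense by (meson not_le)
  then have "0 < r" using p_norm(1)[OF b(1)] by linarith
  define F where "F n z = complex_of_real (flat r n (Re z))" for n z
  define x where "x n = cfc (F n) b" for n
  have real: "spectrum b \<subseteq> complex_of_real ` UNIV"
    using spectrum_real[OF b(2)] by blast
  have F: "continuous_on (spectrum b) (F n)" for n
    unfolding F_def by (rule continuous_on_spectrum[OF smooth_flat[OF \<open>0 < r\<close>] real])
  have x_D: "x n \<in> D" for n
    unfolding x_def F_def
    by (rule cfc_in_D[OF _ b(2) _ real smooth_flat[OF \<open>0 < r\<close>]]) (use b(1) subset in auto)
  have x_star: "star (x n) = x n" for n
  proof -
    have "(\<lambda>z. cnj (F n z)) = F n" by (simp add: F_def fun_eq_iff)
    then show ?thesis using cfc_cnj[OF b(2) F[of n]] by (simp add: x_def)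
  qed
  have F_Suc: "F n z = z * F (Suc n) z" if "z \<in> spectrum b" for n z
    unfolding F_def using spectrum_real[OF b(2) that] flat_eq_mult[OF \<open>0 < r\<close>, of n "Re z"]
    by (metis of_real_mult)
  have x_Suc: "x n = b * x (Suc n)" for n
  proof -
    have "x n = cfc (\<lambda>z. z * F (Suc n) z) b"
      unfolding x_def by (intro cfc_cong b F F_Suc)
    also have "\<dots> = b * x (Suc n)"
      using cfc_mult[OF b(2) continuous_on_id F] by (simp only: cfc_id[OF b(2)] x_def)
    finally show ?thesis .
  qed
  \<comment> \<open>A priori \<open>x n\<close> is only in \<open>D\<close>. Taking adjoints
    rewrites it as \<open>x (Suc n) * b\<close>, to which the one-sided ideal property
    applies.\<close>
  have x_I: "x n \<in> I" for n
  proof -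
    have "x n = star (b * x (Suc n))"
      by (simp add: x_star flip: x_Suc)
    then have "x n = x (Suc n) * b"
      by (simp add: star_mult x_star b)
    then show ?thesis using ideal[OF x_D b(1)] by simp
  qed
  \<comment> \<open>Iterating \<open>x_Suc\<close> splits off n factors \<open>b\<close>, each
    estimated by \<open>p b\<close>.\<close>
  have x_le: "p (x 0) \<le> p b ^ n * p (x n)" for n
  proof (induct n)
    case (Suc n)
    have "p (x n) \<le> p b * p (x (Suc n))"
      using p_norm(6)[OF b(1) x_I[of "Suc n"]] by (simp flip: x_Suc)
    then have "p b ^ n * p (x n) \<le> p b ^ n * (p b * p (x (Suc n)))"
      using p_norm(1)[OF b(1)] by (intro mult_left_mono) auto
    with Suc show ?case by (simp add: mult.assoc mult.left_commute)
  qed simp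
  \<comment> \<open>The inequality \<open>p_le_norm\<close> carries the supremum bound of
    \<open>flat r n\<close> over to \<open>p\<close>.\<close>
  have "p (x n) \<le> (1 / r) ^ n" for n
  proof -
    have "norm (x n) \<le> (1 / r) ^ n"
      unfolding x_def
      using flat_bounds[OF \<open>0 < r\<close>] \<open>0 < r\<close> by (intro norm_cfc_le b F) (simp_all add: F_def)
    then show ?thesis using p_le_norm[OF x_I x_star, of n] by simp
  qed
  then have "p b ^ n * p (x n) \<le> p b ^ n * (1 / r) ^ n" for n
    using p_norm(1)[OF b(1)] by (intro mult_left_mono) auto
  then have "p (x 0) \<le> (p b / r) ^ n" for n
    using x_le[of n] by (simp add: power_divide) (meson order_trans)
  moreover have "(\<lambda>n. (p b / r) ^ n) \<longlonglongrightarrow> 0"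
    using r(1) \<open>0 < r\<close> p_norm(1)[OF b(1)] by (intro LIMSEQ_power_zero) simp
  ultimately have "p (x 0) \<le> 0"
    by (intro LIMSEQ_le_const) auto
  then have "x 0 = 0"
    using p_norm(1,2)[OF x_I[of 0]] by simp
  moreover have "F 0 (complex_of_real (norm b)) \<noteq> 0"
    using r(2) by (simp add: F_def flat_def)
  ultimately show False
    using cfc_nonzero[OF b(2) F sp] by (simp add: x_def)
qed

lemma p_eq_norm_selfadjoint:
  assumes b: "b \<in> I" "star b = b"
  shows "p b = norm b"
proof (rule antisym[OF p_le_norm[OF b]])
  show "norm b \<le> p b"
  proof (cases "b = 0")
    case True
    then show ?thesis using p_norm(1)[OF b(1)] by simp
  next
    case False
    then consider "complex_of_real (norm b) \<in> spectrum b" | "complex_of_real (- norm b) \<in> spectrum b"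
      using norm_in_spectrum[OF b(2)] by blast
    then show ?thesis
    proof cases
      case 1
      then show ?thesis by (rule norm_le_p_of_norm_in_spectrum[OF b])
    next
      case 2
      have neg: "(-1) *\<^sub>C b = - b" by (simp add: scaleC_one)
      have "complex_of_real (norm (- b)) \<in> spectrum (- b)"
      proof (rule ccontr)
        assume "complex_of_real (norm (- b)) \<notin> spectrum (- b)"
        then obtain y where "is_inverse (complex_of_real (norm b) *\<^sub>C \<one> - (- b)) y"
          by (auto simp: not_in_spectrum_iff)
        then have "is_inverse ((-1) *\<^sub>C (complex_of_real (norm b) *\<^sub>C \<one> - (- b))) (inverse (-1) *\<^sub>C y)"
          by (rule is_inverse_scaleC) simp
        moreover have "(-1) *\<^sub>C (complex_of_real (norm b) *\<^sub>C \<one> - (- b)) =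
            complex_of_real (- norm b) *\<^sub>C \<one> - b"
          by (simp add: scaleC_one)
        ultimately show False using 2 not_in_spectrum_iff by metis
      qed
      then have "norm (- b) \<le> p (- b)"
        using I_closed(2)[OF b(1), of "-1"] b(2)
        by (intro norm_le_p_of_norm_in_spectrum) (simp_all add: neg star_minus)
      then show ?thesis
        using p_norm(3)[OF b(1), of "-1"] by (simp add: neg)
    qed
  qed
qed

lemma p_eq_norm:
  assumes "b \<in> I"
  shows "p b = norm b"
proof -
  have "(p b)\<^sup>2 = p (star b * b)" using p_norm(4)[OF assms] by simp
  also have "\<dots> = norm (star b * b)"
    by (intro p_eq_norm_selfadjoint I_closed assms) simp
  also have "\<dots> = (norm b)\<^sup>2" by (rule cstar_identity)
  finally show ?thesis using p_norm(1)[OF assms] by simp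
qed

end

section \<open>Reduction to an ideal in a unital algebra\<close>

lemma generated_subalgebra_insert_unity_ideal:
  assumes "is_unity (unity::'a::complex_star_algebra)" "complex_subalgebra (B :: 'a set)"
    and "d \<in> generated_subalgebra (insert unity B)" "x \<in> B"
  shows "d * x \<in> B"
proof -
  \<comment> \<open>The left multipliers of \<open>B\<close> form a complex subalgebra containing
    \<open>B\<close> and the unit, hence the generated one.\<close>
  let ?C = "{d. \<forall>x\<in>B. d * x \<in> B}"
  have "complex_subalgebra ?C" "insert unity B \<subseteq> ?C"
    using assms(1,2)
    by (auto simp: complex_subalgebra_def is_unity_def distrib_right mult_scaleC_left mult.assoc)
  then show ?thesis
    using assms(3,4) by (auto simp: generated_subalgebra_def)
qed

theorem theorem2p5:
  fixes B :: "'a::cstar_algebra set" and p :: "'a \<Rightarrow> real"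
  assumes "star_subalgebra B"
    and "closure B = UNIV"
    and "smooth_cfc_closed B"
    and "cstar_norm_on B p"
  shows "\<forall>b\<in>B. p b = norm b"
proof
  fix b assume b: "b \<in> B"
  have B: "complex_subalgebra B"
    using assms(1) by (simp add: star_subalgebra_def)
  show "p b = norm b"
  proof (cases "unital TYPE('a)")
    case True
    then have unity: "is_unity (unity::'a)" by (simp add: unital_iff)
    \<comment> \<open>Both unital cases at once: \<open>B\<close> absorbs left multiplication by
      \<open>D\<close> in either of them.\<close>
    define D where "D = (if unity \<in> B then B else generated_subalgebra (insert unity B))"
    have "smooth_cfc_closed_unital D"
      using assms(3) True by (simp add: smooth_cfc_closed_def D_def)
    moreover have "B \<subseteq> D"
      by (auto simp: D_def generated_subalgebra_def)
    moreover have "d * x \<in> B" if "d \<in> D" "x \<in> B" for d x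
      using that B generated_subalgebra_insert_unity_ideal[OF unity B]
      by (auto simp: D_def complex_subalgebra_def split: if_splits)
    ultimately interpret smooth_cfc_ideal unity B D p
      using unity assms by unfold_locales
    show ?thesis using b by (rule p_eq_norm)
  next
    case False
    \<comment> \<open>Without a unit, \<open>B\<close> is carried into the unitization by a
      \<mapsto> (a, 0) and \<open>p\<close> is read off from the first component.\<close>
    let ?I = "(\<lambda>x. Unitization x 0) ` B"
    interpret smooth_cfc_ideal "Unitization 0 1" ?I "unitization_of B" "\<lambda>u. p (alg_part u)"
    proof
      show "is_unity (Unitization 0 1 :: 'a unitization)" by (rule is_unity_unitization)
      show "star_subalgebra ?I"
        using assms(1)
        by (auto simp: star_subalgebra_def complex_subalgebra_def zero_unitization_def
            plus_unitization_def times_unitization_def scaleC_unitization_def star_unitization_def)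
      show "?I \<subseteq> unitization_of B"
        by (auto simp: unitization_of_def)
      show "d * x \<in> ?I" if "d \<in> unitization_of B" "x \<in> ?I" for d x
        using that B
        by (auto simp: unitization_of_def times_unitization_def complex_subalgebra_def)
      show "smooth_cfc_closed_unital (unitization_of B)"
        using assms(3) False by (simp add: smooth_cfc_closed_def)
      show "cstar_norm_on ?I (\<lambda>u. p (alg_part u))"
        using assms(4) by (simp add: cstar_norm_on_def zero_unitization_def times_unitization_def unitization.expand
            star_unitization_def)
    qed
    show ?thesis
      using p_eq_norm[of "Unitization b 0"] b by (simp add: norm_Unitization_zero)
  qed
qed

end
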